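(* Suppose that the following statement (A) is true. (A) For every $n\geq 1$ and all reduced holomorphic function-germs $f,g\colon(\mathbb{C}^n,0)\to (\mathbb{C},0)$: if there is a germ of homeomorphism $\varphi\colon(\mathbb{C}^n,0)\to (\mathbb{C}^n,0)$ such that $f=g\circ \varphi$, then $f_*^{-1}(0)\setminus \{0\}$ and $g_*^{-1}(0)\setminus \{0\}$ have the same homology. Then the following statement (B) is true. (B) For every $n\geq 1$ and all reduced holomorphic function-germs $f,g\colon(\mathbb{C}^n,0)\to (\mathbb{C},0)$: if there is a germ of homeomorphism $\varphi\colon(\mathbb{C}^n,0)\to (\mathbb{C}^n,0)$ such that $f=g\circ \varphi$, then $m(V(f),0)=m(V(g),0)$.
   Context: A holomorphic function-germ $f\colon(\mathbb{C}^n,0)\to(\mathbb{C},0)$, not identically zero, is written $f=f_m+f_{m+1}+\cdots$, where each $f_j$ is identically zero or a homogeneous polynomial of degree $j$, and $f_m\neq 0$. Then $m=\mathrm{ord}_0 f$, and $f_*:=f_m$ is called the initial form of $f$; $f_*^{-1}(0)\subset\mathbb{C}^n$ is its zero set. A germ is reduced if it is not identically zero and has no repeated irreducible factor. $(V(f),0)$ is the germ at $0$ of the zero set of $f$, and for $f$ reduced its multiplicity at the origin is $m(V(f),0):=\mathrm{ord}_0 f$. Two spaces have the same homology if their integral singular homology groups are isomorphic in every degree. *)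

theory Defs
  imports "HOL-Analysis.Analysis" "HOL-Homology.Homology"
begin

section \<open>The space C^n\<close>

text \<open>
  As for \<^const>\<open>Euclidean_space\<close>, a point of C^n is a sequence whose entries from index
  \<open>n\<close> on vanish; the dimension is thus an ordinary natural number that can be quantified over.
\<close>

definition complex_space :: "nat \<Rightarrow> (nat \<Rightarrow> complex) topology"
  where "complex_space n =
    subtopology (product_topology (\<lambda>_. euclidean) UNIV) {z. \<forall>i\<ge>n. z i = 0}"

abbreviation origin :: "nat \<Rightarrow> complex"
  where "origin \<equiv> (\<lambda>_. 0)"


section \<open>Holomorphic function-germs\<close>

text \<open>
  A germ at the origin is handled through its representatives: total functions, of which only the
  values on C^n near the origin matter. Equality of germs is \<open>germ_eq\<close>.
\<close>

definition germ_eq :: "nat \<Rightarrow> ((nat \<Rightarrow> complex) \<Rightarrow> complex) \<Rightarrow> ((nat \<Rightarrow> complex) \<Rightarrow> complex) \<Rightarrow> bool"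
  where "germ_eq n f g \<longleftrightarrow> eventually (\<lambda>z. f z = g z) (nhdsin (complex_space n) origin)"

definition multi_indices :: "nat \<Rightarrow> (nat \<Rightarrow> nat) set"
  where "multi_indices n = {\<alpha>. \<forall>i\<ge>n. \<alpha> i = 0}"

definition monomial :: "nat \<Rightarrow> (nat \<Rightarrow> nat) \<Rightarrow> (nat \<Rightarrow> complex) \<Rightarrow> complex"
  where "monomial n \<alpha> z = (\<Prod>i<n. z i ^ \<alpha> i)"

text \<open>
  Holomorphic functions of several variables are those that can be expanded, around every point
  of an open set, into a power series converging (unconditionally) on a polydisc.
\<close>

definition power_series_at :: "nat \<Rightarrow> ((nat \<Rightarrow> complex) \<Rightarrow> complex) \<Rightarrow> (nat \<Rightarrow> complex) \<Rightarrow> bool"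
  where "power_series_at n f a \<longleftrightarrow>
    (\<exists>c. \<exists>r>0. \<forall>z \<in> topspace (complex_space n). (\<forall>i<n. cmod (z i - a i) < r) \<longrightarrow>
       ((\<lambda>\<alpha>. c \<alpha> * monomial n \<alpha> (\<lambda>i. z i - a i)) has_sum (f z)) (multi_indices n))"

definition holomorphic_germ :: "nat \<Rightarrow> ((nat \<Rightarrow> complex) \<Rightarrow> complex) \<Rightarrow> bool"
  where "holomorphic_germ n f \<longleftrightarrow>
    (\<exists>U. openin (complex_space n) U \<and> origin \<in> U \<and> (\<forall>a\<in>U. power_series_at n f a))"


section \<open>Reduced germs\<close>

definition germ_dvd :: "nat \<Rightarrow> ((nat \<Rightarrow> complex) \<Rightarrow> complex) \<Rightarrow> ((nat \<Rightarrow> complex) \<Rightarrow> complex) \<Rightarrow> bool"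
  where "germ_dvd n p f \<longleftrightarrow> (\<exists>h. holomorphic_germ n h \<and> germ_eq n f (\<lambda>z. p z * h z))"

definition germ_unit :: "nat \<Rightarrow> ((nat \<Rightarrow> complex) \<Rightarrow> complex) \<Rightarrow> bool"
  where "germ_unit n u \<longleftrightarrow> holomorphic_germ n u \<and> germ_dvd n u (\<lambda>_. 1)"

definition germ_irreducible :: "nat \<Rightarrow> ((nat \<Rightarrow> complex) \<Rightarrow> complex) \<Rightarrow> bool"
  where "germ_irreducible n p \<longleftrightarrow>
    holomorphic_germ n p \<and> \<not> germ_eq n p (\<lambda>_. 0) \<and> \<not> germ_unit n p \<and>
    (\<forall>a b. holomorphic_germ n a \<longrightarrow> holomorphic_germ n b \<longrightarrow>
       germ_eq n p (\<lambda>z. a z * b z) \<longrightarrow> germ_unit n a \<or> germ_unit n b)"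

text \<open>Reduced germs (C^n,0) \<open>\<rightarrow>\<close> (C,0); the condition at the origin is part of the definition.\<close>

definition reduced_germ :: "nat \<Rightarrow> ((nat \<Rightarrow> complex) \<Rightarrow> complex) \<Rightarrow> bool"
  where "reduced_germ n f \<longleftrightarrow>
    holomorphic_germ n f \<and> f origin = 0 \<and> \<not> germ_eq n f (\<lambda>_. 0) \<and>
    (\<nexists>p. germ_irreducible n p \<and> germ_dvd n (\<lambda>z. p z * p z) f)"


section \<open>Order and initial form\<close>

definition homogeneous_polynomial :: "nat \<Rightarrow> nat \<Rightarrow> ((nat \<Rightarrow> complex) \<Rightarrow> complex) \<Rightarrow> bool"
  where "homogeneous_polynomial n j P \<longleftrightarrow>
    (\<exists>c. P = (\<lambda>z. \<Sum>\<alpha>\<in>{\<alpha> \<in> multi_indices n. (\<Sum>i<n. \<alpha> i) = j}. c \<alpha> * monomial n \<alpha> z))"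

definition homogeneous_expansion ::
    "nat \<Rightarrow> ((nat \<Rightarrow> complex) \<Rightarrow> complex) \<Rightarrow> (nat \<Rightarrow> (nat \<Rightarrow> complex) \<Rightarrow> complex) \<Rightarrow> bool"
  where "homogeneous_expansion n f P \<longleftrightarrow>
    (\<forall>j. homogeneous_polynomial n j (P j)) \<and>
    eventually (\<lambda>z. (\<lambda>j. P j z) sums f z) (nhdsin (complex_space n) origin)"

text \<open>
  The expansion of a holomorphic germ exists and is unique, also as a family of functions on all
  sequences, since a homogeneous polynomial in \<open>n\<close> variables ignores entries from index \<open>n\<close> on.
\<close>

definition homogeneous_part :: "nat \<Rightarrow> ((nat \<Rightarrow> complex) \<Rightarrow> complex) \<Rightarrow> nat \<Rightarrow> (nat \<Rightarrow> complex) \<Rightarrow> complex"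
  where "homogeneous_part n f = (THE P. homogeneous_expansion n f P)"

definition germ_order :: "nat \<Rightarrow> ((nat \<Rightarrow> complex) \<Rightarrow> complex) \<Rightarrow> nat"
  where "germ_order n f = (LEAST m. homogeneous_part n f m \<noteq> (\<lambda>_. 0))"

definition initial_form :: "nat \<Rightarrow> ((nat \<Rightarrow> complex) \<Rightarrow> complex) \<Rightarrow> (nat \<Rightarrow> complex) \<Rightarrow> complex"
  where "initial_form n f = homogeneous_part n f (germ_order n f)"

text \<open>The multiplicity at the origin of V(f), for \<open>f\<close> a reduced equation.\<close>

definition hypersurface_multiplicity :: "nat \<Rightarrow> ((nat \<Rightarrow> complex) \<Rightarrow> complex) \<Rightarrow> nat"
  where "hypersurface_multiplicity n f = germ_order n f"

definition punctured_initial_cone :: "nat \<Rightarrow> ((nat \<Rightarrow> complex) \<Rightarrow> complex) \<Rightarrow> (nat \<Rightarrow> complex) topology"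
  where "punctured_initial_cone n f =
    subtopology (complex_space n) ({z. initial_form n f z = 0} - {origin})"


section \<open>Topological notions\<close>

definition homeomorphism_germ :: "nat \<Rightarrow> ((nat \<Rightarrow> complex) \<Rightarrow> (nat \<Rightarrow> complex)) \<Rightarrow> bool"
  where "homeomorphism_germ n \<phi> \<longleftrightarrow> \<phi> origin = origin \<and>
    (\<exists>U V. openin (complex_space n) U \<and> openin (complex_space n) V \<and> origin \<in> U \<and> origin \<in> V \<and>
       homeomorphic_map (subtopology (complex_space n) U) (subtopology (complex_space n) V) \<phi>)"

definition same_homology :: "'a topology \<Rightarrow> 'b topology \<Rightarrow> bool"
  where "same_homology X Y \<longleftrightarrow> (\<forall>p. homology_group p X \<cong> homology_group p Y)"

end

theory Submission
  imports Defs "HOL-Complex_Analysis.Conformal_Mappings"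
begin

text \<open>
  Suppose \<open>f = g \<circ> \<phi>\<close> with \<open>m = ord f < k = ord g\<close>. Add three variables and put \<open>d = 2m + 3\<close>,
  \<open>F = f(x)^2 y1 y2 + w^d\<close> and \<open>G = g(x)^2 y1 y2 + w^d\<close>. These germs are reduced and
  \<open>F = G \<circ> (\<phi> \<times> id)\<close>. Since \<open>2m + 2 < d < 2k + 2\<close>, their initial forms are \<open>f_m(x)^2 y1 y2\<close> and
  \<open>w^d\<close>. The punctured cone of \<open>G\<close> is \<open>C^(n+2) - 0\<close>, which has no homology in degree \<open>2n + 2\<close>.
  The punctured cone of \<open>F\<close> has some, because it retracts onto a copy of \<open>R^(2n+3) - 0\<close>: if
  \<open>f_m(v) \<noteq> 0\<close>, then the map \<open>(x, y, w) \<mapsto> (x - |y1 y2| v, w, |y1| - |y2|)\<close> does not vanish on the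
  cone, and it has the section \<open>(x, w, t) \<mapsto> (x, max(t, 0), max(-t, 0), w)\<close>.
\<close>

section \<open>Polydiscs in C^n\<close>

text \<open>Statement (A) sees only the topology of the cones, so a difference of orders has to
  become a difference of topology. Competition with \<open>w^d\<close> achieves this once
  \<open>d\<close> lies strictly between the degrees of the two other forms. Without the square
  these would be \<open>m + 2\<close> and \<open>k + 2\<close>, with no integer between them when
  \<open>k = m + 1\<close>. Squaring doubles the gap, and the summand \<open>w^d\<close> restores
  the reducedness that squaring destroys.

  The factors \<open>y1\<close> and \<open>y2\<close> produce homology that does not depend on the
  unknown zero set of \<open>f_m\<close>. The hyperplanes \<open>y1 = 0\<close> and
  \<open>y2 = 0\<close> lie in the cone and meet in the space C^(n+1) of the pairs
  \<open>(x, w)\<close>. The section puts one half of R^(2n+3) into each of them, so the unit sphere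
  becomes a suspension of the unit sphere of C^(n+1). The zeros of \<open>f_m\<close> might fill
  this sphere in. The term \<open>|y1 y2| v\<close> excludes that: a point with
  \<open>x = |y1 y2| v\<close> and \<open>y1 y2 \<noteq> 0\<close> is off the cone.\<close>

definition trunc_at :: "nat \<Rightarrow> (nat \<Rightarrow> complex) \<Rightarrow> nat \<Rightarrow> complex"
  where "trunc_at n z = (\<lambda>i. if i < n then z i else 0)"

definition polydisc :: "nat \<Rightarrow> real \<Rightarrow> (nat \<Rightarrow> complex) set"
  where "polydisc n r = {z \<in> topspace (complex_space n). \<forall>i<n. cmod (z i) < r}"

lemma topspace_complex_space: "topspace (complex_space n) = {z. \<forall>i\<ge>n. z i = 0}"
  by (simp add: complex_space_def)

lemma complex_space_eq_top_of_set: "complex_space n = top_of_set {z. \<forall>i\<ge>n. z i = 0}"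
  by (simp add: complex_space_def euclidean_product_topology)

lemma continuous_map_into_complex_space:
  "continuous_map X (complex_space n) f \<longleftrightarrow>
    (\<forall>i. continuous_map X euclidean (\<lambda>x. f x i)) \<and> (\<forall>x\<in>topspace X. \<forall>i\<ge>n. f x i = 0)"
  unfolding complex_space_def
  by (auto simp: continuous_map_in_subtopology continuous_map_componentwise_UNIV)

lemma continuous_map_complex_space_coordinate [continuous_intros]:
  "continuous_map (complex_space n) euclidean (\<lambda>z. z i)"
  unfolding complex_space_def
  by (intro continuous_map_from_subtopology continuous_map_product_projection) auto

lemma openin_polydisc: "openin (complex_space n) (polydisc n r)"
proof -
  have "openin (complex_space n) {z \<in> topspace (complex_space n). z i \<in> ball 0 r}" for i
    by (rule openin_continuous_map_preimage[OF continuous_map_complex_space_coordinate])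
       (simp only: open_openin[symmetric] open_ball)
  then have "openin (complex_space n)
      ((\<Inter>i\<in>{..<n}. {z \<in> topspace (complex_space n). z i \<in> ball 0 r}) \<inter> topspace (complex_space n))"
    by (intro openin_INT) auto
  moreover have "(\<Inter>i\<in>{..<n}. {z \<in> topspace (complex_space n). z i \<in> ball 0 r}) \<inter> topspace (complex_space n)
      = polydisc n r"
    by (auto simp: polydisc_def)
  ultimately show ?thesis by simp
qed

lemma origin_in_complex_space [simp]: "origin \<in> topspace (complex_space n)"
  by (simp add: topspace_complex_space)

lemma origin_in_polydisc: "0 < r \<Longrightarrow> origin \<in> polydisc n r"
  by (simp add: polydisc_def)

lemma polydisc_mono: "r \<le> s \<Longrightarrow> polydisc n r \<subseteq> polydisc n s"
  by (force simp: polydisc_def)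

lemma polydisc_subset: "z \<in> polydisc n r \<Longrightarrow> z \<in> topspace (complex_space n)"
  by (simp add: polydisc_def)

text \<open>A basic open box of the product topology prescribes a set \<open>X i\<close> for every
  index. Entries from \<open>n\<close> on are 0 and lie in \<open>X i\<close> because the origin
  does, so only the \<open>n\<close> free coordinates bound the radius.\<close>

lemma openin_contains_polydisc:
  assumes "openin (complex_space n) U" "origin \<in> U"
  obtains r where "0 < r" "polydisc n r \<subseteq> U"
proof -
  obtain T where T: "openin (product_topology (\<lambda>_. euclidean) UNIV) T"
    and U: "U = T \<inter> {z. \<forall>i\<ge>n. z i = 0}"
    using assms(1) unfolding complex_space_def openin_subtopology by auto
  then have "origin \<in> T" using assms(2) by auto
  then obtain X where X: "origin \<in> Pi\<^sub>E UNIV X" "\<forall>i. openin euclidean (X i)" "Pi\<^sub>E UNIV X \<subseteq> T"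
    using product_topology_open_contains_basis[OF T \<open>origin \<in> T\<close>] by blast
  have "\<exists>e>0. ball 0 e \<subseteq> X i" for i
  proof -
    have "open (X i)" "0 \<in> X i" using X(1,2) by (auto simp: PiE_iff)
    then show ?thesis by (meson open_contains_ball)
  qed
  then obtain e where e: "\<And>i. 0 < e i" "\<And>i. ball 0 (e i) \<subseteq> X i" by metis
  \<comment> \<open>Inserting 1 keeps the set nonempty when \<open>n = 0\<close>.\<close>
  define r where "r = Min (insert 1 (e ` {..<n}))"
  show thesis
  proof
    show "0 < r" by (auto simp: r_def e)
    show "polydisc n r \<subseteq> U"
    proof
      fix z assume z: "z \<in> polydisc n r"
      have "z i \<in> X i" for i
      proof (cases "i < n")
        case True
        then have "r \<le> e i" by (auto simp: r_def)
        moreover have "cmod (z i) < r" using z True by (auto simp: polydisc_def)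
        ultimately show ?thesis using e(2)[of i] by auto
      next
        case False
        then show ?thesis using z X(1) by (auto simp: polydisc_def topspace_complex_space PiE_def Pi_def)
      qed
      then show "z \<in> U" using z X(3) U by (auto simp: polydisc_def topspace_complex_space)
    qed
  qed
qed

lemma eventually_nhdsin_complex_space:
  "eventually P (nhdsin (complex_space n) origin) \<longleftrightarrow> (\<exists>r>0. \<forall>z\<in>polydisc n r. P z)"
proof
  assume "eventually P (nhdsin (complex_space n) origin)"
  then obtain S where S: "openin (complex_space n) S" "origin \<in> S" "\<forall>x\<in>S. P x"
    by (auto simp: eventually_nhdsin)
  from S(1,2) obtain r where "0 < r" "polydisc n r \<subseteq> S"
    by (rule openin_contains_polydisc)
  with S(3) show "\<exists>r>0. \<forall>z\<in>polydisc n r. P z"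
    by (intro exI[of _ r]) auto
next
  assume "\<exists>r>0. \<forall>z\<in>polydisc n r. P z"
  then obtain r where "0 < r" "\<forall>z\<in>polydisc n r. P z" by auto
  then show "eventually P (nhdsin (complex_space n) origin)"
    unfolding eventually_nhdsin
    by (intro disjI2 exI[of _ "polydisc n r"] conjI openin_polydisc origin_in_polydisc) auto
qed

lemma germ_eq_iff: "germ_eq n f g \<longleftrightarrow> (\<exists>r>0. \<forall>z\<in>polydisc n r. f z = g z)"
  by (simp add: germ_eq_def eventually_nhdsin_complex_space)

lemma holomorphic_germ_iff:
  "holomorphic_germ n f \<longleftrightarrow> (\<exists>r>0. \<forall>a\<in>polydisc n r. power_series_at n f a)"
proof
  assume "holomorphic_germ n f"
  then obtain U where U: "openin (complex_space n) U" "origin \<in> U" "\<forall>a\<in>U. power_series_at n f a"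
    unfolding holomorphic_germ_def by blast
  from U(1,2) obtain r where "0 < r" "polydisc n r \<subseteq> U"
    by (rule openin_contains_polydisc)
  with U(3) show "\<exists>r>0. \<forall>a\<in>polydisc n r. power_series_at n f a"
    by (intro exI[of _ r]) auto
next
  assume "\<exists>r>0. \<forall>a\<in>polydisc n r. power_series_at n f a"
  then obtain r where "0 < r" "\<forall>a\<in>polydisc n r. power_series_at n f a" by auto
  then show "holomorphic_germ n f"
    unfolding holomorphic_germ_def
    by (intro exI[of _ "polydisc n r"] conjI openin_polydisc origin_in_polydisc) auto
qed

lemma trunc_at_apply: "i < n \<Longrightarrow> trunc_at n z i = z i"
  by (simp add: trunc_at_def)

lemma trunc_at_in_complex_space [simp]: "trunc_at n z \<in> topspace (complex_space n)"
  by (simp add: trunc_at_def topspace_complex_space)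

lemma trunc_at_id: "z \<in> topspace (complex_space n) \<Longrightarrow> trunc_at n z = z"
  by (auto simp: trunc_at_def topspace_complex_space)

lemma trunc_at_trunc_at [simp]: "m \<le> n \<Longrightarrow> trunc_at m (trunc_at n z) = trunc_at m z"
  by (auto simp: trunc_at_def)

lemma trunc_at_origin [simp]: "trunc_at n origin = origin"
  by (simp add: trunc_at_def)

lemma trunc_at_in_polydisc: "z \<in> polydisc N r \<Longrightarrow> n \<le> N \<Longrightarrow> trunc_at n z \<in> polydisc n r"
  by (auto simp: polydisc_def trunc_at_def topspace_complex_space)

section \<open>Power series in several variables\<close>

lemma monomial_add: "monomial n (\<lambda>i. \<alpha> i + \<beta> i) z = monomial n \<alpha> z * monomial n \<beta> z"
  by (simp add: monomial_def power_add prod.distrib)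

lemma monomial_zero [simp]: "monomial n (\<lambda>_. 0) z = 1"
  by (simp add: monomial_def)

lemma monomial_cong: "(\<And>i. i < n \<Longrightarrow> z i = w i) \<Longrightarrow> monomial n \<alpha> z = monomial n \<alpha> w"
  by (simp add: monomial_def)

lemma norm_monomial: "norm (monomial n \<alpha> z) = (\<Prod>i<n. cmod (z i) ^ \<alpha> i)"
  by (simp add: monomial_def norm_power flip: prod_norm)

lemma monomial_const: "monomial n \<alpha> (\<lambda>i. c) = c ^ (\<Sum>i<n. \<alpha> i)"
  by (simp add: monomial_def power_sum)

lemma monomial_scale: "monomial n \<alpha> (\<lambda>i. c * z i) = c ^ (\<Sum>i<n. \<alpha> i) * monomial n \<alpha> z"
  by (simp add: monomial_def power_sum power_mult_distrib prod.distrib)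

lemma norm_monomial_le:
  assumes "\<And>i. i < n \<Longrightarrow> cmod (z i) \<le> \<delta>"
  shows "norm (monomial n \<alpha> z) \<le> \<delta> ^ (\<Sum>i<n. \<alpha> i)"
  unfolding norm_monomial power_sum
  by (intro prod_mono) (auto intro: power_mono assms)

text \<open>Sums are unconditional, so terms with the same \<open>expo i\<close> may be collected:
  write the family over the disjoint union of the fibres and sum fibre by fibre. With
  \<open>J\<close> the multi-indices, a series over any index set becomes a power series; with
  \<open>J\<close> the degrees, homogeneous parts are collected.\<close>

lemma has_sum_fibres:
  fixes b :: "'i \<Rightarrow> complex"
  assumes "expo ` I \<subseteq> J" "((\<lambda>i. b i * m (expo i)) has_sum s) I"
  shows "((\<lambda>j. infsum b {i\<in>I. expo i = j} * m j) has_sum s) J"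
proof -
  let ?S = "SIGMA j:J. {i\<in>I. expo i = j}"
  have "((\<lambda>(j,i). b i * m j) has_sum s) ?S"
    using assms
    by (subst has_sum_reindex_bij_witness[of _ "\<lambda>i. (expo i, i)" snd I "\<lambda>i. b i * m (expo i)" _ s]) auto
  moreover have "((\<lambda>i. b i * m j) has_sum infsum b {i\<in>I. expo i = j} * m j) {i\<in>I. expo i = j}" for j
  proof -
    have "(\<lambda>i. b i * m (expo i)) summable_on {i\<in>I. expo i = j}"
      using assms(2) by (intro summable_on_subset_banach[OF has_sum_imp_summable]) auto
    then have "(\<lambda>i. b i * m j) summable_on {i\<in>I. expo i = j}"
      by (rule summable_on_cong[THEN iffD1, rotated]) auto
    \<comment> \<open>If \<open>m j = 0\<close>, the coefficients \<open>b\<close> need not be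
      summable on the fibre. The sum of the products is 0 in that case, whatever value
      \<open>infsum\<close> takes.\<close>
    then show ?thesis
      unfolding infsum_cmult_left'[symmetric] by (rule has_sum_infsum)
  qed
  ultimately show ?thesis
    by (intro has_sum_SigmaD[where f = "\<lambda>(j,i). b i * m j" and B = "\<lambda>j. {i\<in>I. expo i = j}"]) auto
qed

text \<open>The index set \<open>I\<close> is arbitrary because products come expanded over pairs of
  multi-indices and inverses over lists of them; many indices may share one exponent.\<close>

lemma power_series_atI:
  assumes "0 < r" "expo ` I \<subseteq> multi_indices n"
    and "\<And>z. z \<in> topspace (complex_space n) \<Longrightarrow> (\<And>i. i < n \<Longrightarrow> cmod (z i - a i) < r) \<Longrightarrow>
      ((\<lambda>i. b i * monomial n (expo i) (\<lambda>i. z i - a i)) has_sum f z) I"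
  shows "power_series_at n f a"
  unfolding power_series_at_def
  by (intro exI[of _ "\<lambda>\<gamma>. infsum b {i\<in>I. expo i = \<gamma>}"] exI[of _ r] conjI ballI impI assms(1)
      has_sum_fibres[OF assms(2)] assms(3)) auto

section \<open>Constants, coordinates, sums and products\<close>

lemma power_series_at_const: "power_series_at n (\<lambda>_. c) a"
  by (rule power_series_atI[of 1 "\<lambda>_ _. 0" "{()}" _ _ "\<lambda>_. c"])
     (auto simp: multi_indices_def intro: has_sum_finiteI)

lemma power_series_at_diff_coordinate:
  assumes "j < n"
  shows "power_series_at n (\<lambda>z. z j - a j) a"
proof (rule power_series_atI[of 1 "\<lambda>_ i. if i = j then 1 else 0" "{()}" _ _ "\<lambda>_. 1"])
  have "monomial n (\<lambda>i. if i = j then 1 else 0) w = w j" for w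
  proof -
    have "monomial n (\<lambda>i. if i = j then 1 else 0) w = (\<Prod>i<n. if i = j then w j else 1)"
      unfolding monomial_def by (intro prod.cong) auto
    then show ?thesis using assms by simp
  qed
  then show "((\<lambda>i. 1 * monomial n (\<lambda>i. if i = j then 1 else 0) (\<lambda>i. z i - a i)) has_sum z j - a j) {()}" for z
    by (auto intro: has_sum_finiteI)
qed (use assms in \<open>auto simp: multi_indices_def\<close>)

lemma power_series_at_add:
  assumes "power_series_at n f a" "power_series_at n g a"
  shows "power_series_at n (\<lambda>z. f z + g z) a"
proof -
  obtain c r where "r > 0" and c: "\<And>z. z \<in> topspace (complex_space n) \<Longrightarrow> (\<forall>i<n. cmod (z i - a i) < r) \<Longrightarrow>
       ((\<lambda>\<alpha>. c \<alpha> * monomial n \<alpha> (\<lambda>i. z i - a i)) has_sum (f z)) (multi_indices n)"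
    using assms(1) unfolding power_series_at_def by blast
  obtain d s where "s > 0" and d: "\<And>z. z \<in> topspace (complex_space n) \<Longrightarrow> (\<forall>i<n. cmod (z i - a i) < s) \<Longrightarrow>
       ((\<lambda>\<alpha>. d \<alpha> * monomial n \<alpha> (\<lambda>i. z i - a i)) has_sum (g z)) (multi_indices n)"
    using assms(2) unfolding power_series_at_def by blast
  show ?thesis
    unfolding power_series_at_def
  proof (intro exI[of _ "\<lambda>\<alpha>. c \<alpha> + d \<alpha>"] exI[of _ "min r s"] conjI ballI impI)
    fix z assume "z \<in> topspace (complex_space n)" "\<forall>i<n. cmod (z i - a i) < min r s"
    then show "((\<lambda>\<alpha>. (c \<alpha> + d \<alpha>) * monomial n \<alpha> (\<lambda>i. z i - a i)) has_sum (f z + g z)) (multi_indices n)"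
      using has_sum_add[OF c[of z] d[of z]] by (simp add: algebra_simps)
  qed (use \<open>r > 0\<close> \<open>s > 0\<close> in auto)
qed

lemma power_series_at_coordinate:
  assumes "j < n"
  shows "power_series_at n (\<lambda>z. z j) a"
  using power_series_at_add[OF power_series_at_diff_coordinate[OF assms, of a] power_series_at_const[of n "a j" a]]
  by simp

text \<open>For complex families summable means absolutely summable, so the norms of the products
  are summable over \<open>A \<times> B\<close> and the double sum may be evaluated row by
  row.\<close>

lemma has_sum_mult_complex:
  fixes f :: "'i \<Rightarrow> complex"
  assumes f: "(f has_sum s) A" and g: "(g has_sum t) B"
  shows "((\<lambda>(x,y). f x * g y) has_sum s * t) (A \<times> B)"
proof (rule has_sum_SigmaI)
  show "((\<lambda>y. (case (x, y) of (x, y) \<Rightarrow> f x * g y)) has_sum f x * t) B" for x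
    using has_sum_cmult_right[OF g] by auto
  show "((\<lambda>x. f x * t) has_sum s * t) A"
    by (rule has_sum_cmult_left[OF f])
  have f': "(\<lambda>x. norm (f x)) summable_on A" and g': "(\<lambda>x. norm (g x)) summable_on B"
    using f g summable_on_iff_abs_summable_on_complex has_sum_imp_summable by blast+
  have "(\<lambda>(x,y). norm (f x) * norm (g y)) summable_on A \<times> B"
    by (rule summable_on_SigmaI[where g = "\<lambda>x. norm (f x) * infsum (\<lambda>y. norm (g y)) B"])
       (use f' g' in \<open>auto intro!: has_sum_cmult_right has_sum_infsum summable_on_cmult_left\<close>)
  then have "(\<lambda>p. norm (case p of (x,y) \<Rightarrow> f x * g y)) summable_on A \<times> B"
    by (simp add: case_prod_unfold norm_mult)
  then show "(\<lambda>(x,y). f x * g y) summable_on A \<times> B"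
    by (simp add: summable_on_iff_abs_summable_on_complex)
qed

lemma power_series_at_mult:
  assumes "power_series_at n f a" "power_series_at n g a"
  shows "power_series_at n (\<lambda>z. f z * g z) a"
proof -
  obtain c r where "r > 0" and c: "\<And>z. z \<in> topspace (complex_space n) \<Longrightarrow> (\<forall>i<n. cmod (z i - a i) < r) \<Longrightarrow>
       ((\<lambda>\<alpha>. c \<alpha> * monomial n \<alpha> (\<lambda>i. z i - a i)) has_sum (f z)) (multi_indices n)"
    using assms(1) unfolding power_series_at_def by blast
  obtain d s where "s > 0" and d: "\<And>z. z \<in> topspace (complex_space n) \<Longrightarrow> (\<forall>i<n. cmod (z i - a i) < s) \<Longrightarrow>
       ((\<lambda>\<alpha>. d \<alpha> * monomial n \<alpha> (\<lambda>i. z i - a i)) has_sum (g z)) (multi_indices n)"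
    using assms(2) unfolding power_series_at_def by blast
  show ?thesis
  proof (rule power_series_atI[of "min r s" "\<lambda>(\<alpha>,\<beta>) i. \<alpha> i + \<beta> i" "multi_indices n \<times> multi_indices n" _ _
        "\<lambda>(\<alpha>,\<beta>). c \<alpha> * d \<beta>"])
    fix z assume "z \<in> topspace (complex_space n)" "\<And>i. i < n \<Longrightarrow> cmod (z i - a i) < min r s"
    then show "((\<lambda>p. (case p of (\<alpha>,\<beta>) \<Rightarrow> c \<alpha> * d \<beta>) * monomial n ((case p of (\<alpha>,\<beta>) \<Rightarrow> \<lambda>i. \<alpha> i + \<beta> i)) (\<lambda>i. z i - a i))
        has_sum (f z * g z)) (multi_indices n \<times> multi_indices n)"
      using has_sum_mult_complex[OF c[of z] d[of z]]
      by (simp add: case_prod_unfold monomial_add mult_ac)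
  qed (use \<open>r > 0\<close> \<open>s > 0\<close> in \<open>auto simp: multi_indices_def\<close>)
qed

lemma power_series_at_power: "power_series_at n f a \<Longrightarrow> power_series_at n (\<lambda>z. f z ^ k) a"
  by (induction k) (auto intro: power_series_at_const power_series_at_mult)

text \<open>This is pullback along the projection of C^N onto C^n. \<open>multi_indices n\<close> is
  contained in \<open>multi_indices N\<close>, so the same coefficients serve.\<close>

lemma power_series_at_trunc_at:
  assumes "power_series_at n f (trunc_at n a)" "n \<le> N"
  shows "power_series_at N (\<lambda>z. f (trunc_at n z)) a"
proof -
  obtain c r where "r > 0" and c: "\<And>z. z \<in> topspace (complex_space n) \<Longrightarrow> (\<forall>i<n. cmod (z i - trunc_at n a i) < r) \<Longrightarrow>
       ((\<lambda>\<alpha>. c \<alpha> * monomial n \<alpha> (\<lambda>i. z i - trunc_at n a i)) has_sum (f z)) (multi_indices n)"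
    using assms(1) unfolding power_series_at_def by blast
  show ?thesis
  proof (rule power_series_atI[of r "\<lambda>\<alpha>. \<alpha>" "multi_indices n" _ _ c])
    fix z assume z: "z \<in> topspace (complex_space N)" "\<And>i. i < N \<Longrightarrow> cmod (z i - a i) < r"
    have "monomial N \<alpha> (\<lambda>i. z i - a i) = monomial n \<alpha> (\<lambda>i. trunc_at n z i - trunc_at n a i)"
      if "\<alpha> \<in> multi_indices n" for \<alpha>
      unfolding monomial_def
      by (rule prod.mono_neutral_cong_right) (use that \<open>n \<le> N\<close> in \<open>auto simp: multi_indices_def trunc_at_def\<close>)
    moreover have "((\<lambda>\<alpha>. c \<alpha> * monomial n \<alpha> (\<lambda>i. trunc_at n z i - trunc_at n a i)) has_sum f (trunc_at n z)) (multi_indices n)"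
      by (rule c) (use z \<open>n \<le> N\<close> in \<open>auto simp: trunc_at_def topspace_complex_space\<close>)
    ultimately show "((\<lambda>\<alpha>. c \<alpha> * monomial N \<alpha> (\<lambda>i. z i - a i)) has_sum f (trunc_at n z)) (multi_indices n)"
      by (subst has_sum_cong) auto
  qed (use \<open>r > 0\<close> \<open>n \<le> N\<close> in \<open>auto simp: multi_indices_def\<close>)
qed

section \<open>Inverses by geometric series\<close>

lemma has_sum_prod_list_length:
  fixes h :: "'i \<Rightarrow> complex"
  assumes "(h has_sum q) A"
  shows "((\<lambda>xs. prod_list (map h xs)) has_sum q ^ k) {xs \<in> lists A. length xs = k}"
proof (induction k)
  case 0
  have eq: "{xs \<in> lists A. length xs = 0} = {[]}" by auto
  show ?case unfolding eq by (rule has_sum_finiteI) auto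
next
  case (Suc k)
  have "((\<lambda>(x,xs). h x * prod_list (map h xs)) has_sum q * q ^ k) (A \<times> {xs \<in> lists A. length xs = k})"
    by (rule has_sum_mult_complex[OF assms Suc])
  then show ?case
    by (subst has_sum_reindex_bij_witness[of _ "\<lambda>(x,xs). x # xs" "\<lambda>ys. (hd ys, tl ys)"
          "A \<times> {xs \<in> lists A. length xs = k}" "\<lambda>(x,xs). h x * prod_list (map h xs)" _ _ "q * q ^ k"])
       (auto simp: length_Suc_conv)
qed

text \<open>Each power \<open>q ^ k\<close> of the geometric series is expanded over the lists of
  length \<open>k\<close>. Lists remember the order, so no multinomial coefficients appear. The
  norms over these lists add up to \<open>\<theta> ^ k\<close>, so \<open>\<theta> < 1\<close> makes
  the whole family summable, which \<open>cmod q < 1\<close> alone would not.\<close>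

lemma has_sum_geometric_lists:
  fixes h :: "'i \<Rightarrow> complex"
  assumes h: "(h has_sum q) A" and nh: "((\<lambda>i. cmod (h i)) has_sum \<theta>) A" and "\<theta> < 1"
  shows "((\<lambda>xs. prod_list (map h xs)) has_sum inverse (1 - q)) (lists A)"
proof -
  let ?L = "\<lambda>k. {xs \<in> lists A. length xs = k}"
  have "0 \<le> \<theta>" by (rule has_sum_nonneg[OF nh]) auto
  have "cmod q \<le> \<theta>" using norm_has_sum_bound[OF nh h] .
  with \<open>\<theta> < 1\<close> have q: "cmod q < 1" by simp
  have norms: "((\<lambda>xs. cmod (prod_list (map h xs))) has_sum \<theta> ^ k) (?L k)" for k
  proof -
    \<comment> \<open>The lemma on powers speaks of complex families, so the norms are viewed as
      complex numbers.\<close>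
    have "((\<lambda>i. complex_of_real (cmod (h i))) has_sum of_real \<theta>) A"
      using nh by (rule has_sum_of_real)
    from has_sum_prod_list_length[OF this, of k]
    have "((\<lambda>xs. prod_list (map (\<lambda>i. complex_of_real (cmod (h i))) xs)) has_sum of_real \<theta> ^ k) (?L k)" .
    moreover have "prod_list (map (\<lambda>i. complex_of_real (cmod (h i))) xs) = of_real (cmod (prod_list (map h xs)))" for xs
      by (induction xs) (auto simp: norm_mult)
    ultimately show ?thesis by (simp only: has_sum_of_real_iff flip: of_real_power)
  qed
  have "summable (\<lambda>k. \<theta> ^ k)" using \<open>0 \<le> \<theta>\<close> \<open>\<theta> < 1\<close> by (simp add: summable_geometric)
  then have "(\<lambda>k. \<theta> ^ k) summable_on UNIV"
    using \<open>0 \<le> \<theta>\<close> by (simp add: summable_on_UNIV_nonneg_real_iff)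
  then have "(\<lambda>(k,xs). cmod (prod_list (map h xs))) summable_on Sigma UNIV ?L"
    by (intro summable_on_SigmaI[where g = "\<lambda>k. \<theta> ^ k"]) (use norms in auto)
  then have "(\<lambda>(k,xs). prod_list (map h xs)) summable_on Sigma UNIV ?L"
    by (simp add: summable_on_iff_abs_summable_on_complex case_prod_unfold)
  moreover have "((\<lambda>k. q ^ k) has_sum inverse (1 - q)) UNIV"
    using q geometric_sums[of q] summable_geometric[of "cmod q"]
    by (intro norm_summable_imp_has_sum) (auto simp: norm_power divide_inverse)
  ultimately have "((\<lambda>(k,xs). prod_list (map h xs)) has_sum inverse (1 - q)) (Sigma UNIV ?L)"
    using has_sum_prod_list_length[OF h] by (intro has_sum_SigmaI[where g = "\<lambda>k. q ^ k"]) auto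
  then show ?thesis
    by (subst has_sum_reindex_bij_witness[of _ snd "\<lambda>xs. (length xs, xs)" "Sigma UNIV ?L"
          "\<lambda>(k,xs). prod_list (map h xs)" _ _ "inverse (1 - q)"]) auto
qed

lemma multi_index_nonzero:
  assumes "\<alpha> \<in> multi_indices n - {\<lambda>_. 0}"
  obtains i where "i < n" "\<alpha> i \<noteq> 0"
proof -
  obtain i where "\<alpha> i \<noteq> 0" using assms by (auto simp: fun_eq_iff)
  moreover from this have "\<not> n \<le> i" using assms by (auto simp: multi_indices_def)
  ultimately show thesis using that[of i] by simp
qed

text \<open>Every nonconstant monomial has degree at least 1, so shrinking the radius from
  \<open>r\<close> to \<open>\<delta>\<close> gains at least the factor \<open>\<delta> / r\<close>.
  The resulting bound \<open>K * \<delta>\<close> on the sum of the norms yields continuity and the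
  convergence of the geometric series for an inverse.\<close>

lemma power_series_atE:
  assumes "power_series_at n f a" "a \<in> topspace (complex_space n)"
  obtains c r K where "0 < r" "0 \<le> K"
    "\<And>z. z \<in> topspace (complex_space n) \<Longrightarrow> (\<And>i. i < n \<Longrightarrow> cmod (z i - a i) \<le> r) \<Longrightarrow>
      ((\<lambda>\<alpha>. c \<alpha> * monomial n \<alpha> (\<lambda>i. z i - a i)) has_sum f z) (multi_indices n)"
    "\<And>z. z \<in> topspace (complex_space n) \<Longrightarrow> (\<And>i. i < n \<Longrightarrow> cmod (z i - a i) \<le> r) \<Longrightarrow>
      ((\<lambda>\<alpha>. c \<alpha> * monomial n \<alpha> (\<lambda>i. z i - a i)) has_sum (f z - f a)) (multi_indices n - {\<lambda>_. 0})"
    "\<And>z \<delta>. z \<in> topspace (complex_space n) \<Longrightarrow> 0 < \<delta> \<Longrightarrow> \<delta> \<le> r \<Longrightarrow> (\<And>i. i < n \<Longrightarrow> cmod (z i - a i) \<le> \<delta>) \<Longrightarrow>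
      \<exists>\<theta>\<le>K * \<delta>. ((\<lambda>\<alpha>. cmod (c \<alpha> * monomial n \<alpha> (\<lambda>i. z i - a i))) has_sum \<theta>) (multi_indices n - {\<lambda>_. 0})"
proof -
  let ?M = "multi_indices n" and ?M' = "multi_indices n - {\<lambda>_. 0}"
  obtain c R where "R > 0" and c: "\<And>z. z \<in> topspace (complex_space n) \<Longrightarrow> (\<forall>i<n. cmod (z i - a i) < R) \<Longrightarrow>
       ((\<lambda>\<alpha>. c \<alpha> * monomial n \<alpha> (\<lambda>i. z i - a i)) has_sum (f z)) ?M"
    using assms(1) unfolding power_series_at_def by blast
  \<comment> \<open>Half the radius, so that the series converges on the closed polydisc, in
    particular at the corner with all coordinates \<open>a i + r\<close>.\<close>
  define r where "r = R / 2"
  have r: "0 < r" "r < R" using \<open>R > 0\<close> by (auto simp: r_def)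
  have zero: "(\<lambda>_. 0) \<in> ?M" by (simp add: multi_indices_def)
  \<comment> \<open>The sum of the norms of the nonconstant terms at that corner, divided by
    \<open>r\<close>.\<close>
  define K where "K = infsum (\<lambda>\<alpha>. cmod (c \<alpha>) * r ^ (\<Sum>i<n. \<alpha> i)) ?M' / r"
  have "(\<lambda>\<alpha>. c \<alpha> * monomial n \<alpha> (\<lambda>i. (if i < n then a i + of_real r else 0) - a i)) summable_on ?M"
    by (rule has_sum_imp_summable, rule c) (use r in \<open>auto simp: topspace_complex_space\<close>)
  also have "(\<lambda>\<alpha>. c \<alpha> * monomial n \<alpha> (\<lambda>i. (if i < n then a i + of_real r else 0) - a i)) =
      (\<lambda>\<alpha>. c \<alpha> * of_real (r ^ (\<Sum>i<n. \<alpha> i)))"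
    by (subst monomial_cong[where w = "\<lambda>_. of_real r"]) (auto simp: monomial_const)
  finally have "(\<lambda>\<alpha>. cmod (c \<alpha>) * r ^ (\<Sum>i<n. \<alpha> i)) summable_on ?M"
    using r by (simp add: summable_on_iff_abs_summable_on_complex norm_mult norm_power)
  then have sum': "(\<lambda>\<alpha>. cmod (c \<alpha>) * r ^ (\<Sum>i<n. \<alpha> i)) summable_on ?M'"
    by (rule summable_on_subset_banach) auto
  \<comment> \<open>Evaluate at the centre: every monomial except the constant one has a factor
    0.\<close>
  have c0: "c (\<lambda>_. 0) = f a"
  proof -
    have "((\<lambda>\<alpha>. c \<alpha> * monomial n \<alpha> (\<lambda>i. a i - a i)) has_sum c (\<lambda>_. 0)) ?M"
    proof (rule has_sum_finite_neutralI)
      show "finite {\<lambda>_::nat. 0::nat}" by simp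
      show "c \<alpha> * monomial n \<alpha> (\<lambda>i. a i - a i) = 0" if "\<alpha> \<in> ?M - {\<lambda>_. 0}" for \<alpha>
      proof -
        from that obtain i where "i < n" "\<alpha> i \<noteq> 0"
          by (rule multi_index_nonzero)
        then show ?thesis by (auto simp: monomial_def intro!: prod_zero)
      qed
    qed (use zero in auto)
    then show ?thesis
      using c[of a] assms(2) \<open>R > 0\<close> has_sum_unique by fastforce
  qed
  show thesis
  proof (rule that[of r K c])
    show "0 \<le> K" unfolding K_def using r by (intro divide_nonneg_nonneg infsum_nonneg) auto
    fix z assume z: "z \<in> topspace (complex_space n)"
    { assume "\<And>i. i < n \<Longrightarrow> cmod (z i - a i) \<le> r"
      then show hs: "((\<lambda>\<alpha>. c \<alpha> * monomial n \<alpha> (\<lambda>i. z i - a i)) has_sum f z) ?M"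
        using r by (intro c z) fastforce
      have "((\<lambda>\<alpha>. c \<alpha> * monomial n \<alpha> (\<lambda>i. z i - a i)) has_sum (f z - f a)) (?M - {\<lambda>_. 0})"
      proof (rule has_sum_Diff[OF hs])
        show "((\<lambda>\<alpha>. c \<alpha> * monomial n \<alpha> (\<lambda>i. z i - a i)) has_sum f a) {\<lambda>_. 0}"
          by (rule has_sum_finiteI) (auto simp: c0)
      qed (use zero in auto)
      then show "((\<lambda>\<alpha>. c \<alpha> * monomial n \<alpha> (\<lambda>i. z i - a i)) has_sum (f z - f a)) ?M'" . }
    fix \<delta> assume \<delta>: "0 < \<delta>" "\<delta> \<le> r" "\<And>i. i < n \<Longrightarrow> cmod (z i - a i) \<le> \<delta>"
    have le: "cmod (c \<alpha> * monomial n \<alpha> (\<lambda>i. z i - a i)) \<le> \<delta> / r * (cmod (c \<alpha>) * r ^ (\<Sum>i<n. \<alpha> i))"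
      if "\<alpha> \<in> ?M'" for \<alpha>
    proof -
      from that obtain i where "i < n" "\<alpha> i \<noteq> 0"
        by (rule multi_index_nonzero)
      then have "0 < (\<Sum>i<n. \<alpha> i)" by (intro sum_pos2[where i = i]) auto
      then obtain m where m: "(\<Sum>i<n. \<alpha> i) = Suc m" using gr0_implies_Suc by blast
      have "\<delta> ^ Suc m \<le> \<delta> * r ^ m"
        using \<delta>(1,2) by (simp add: power_mono)
      also have "\<dots> = \<delta> / r * r ^ Suc m" using r by simp
      finally have "\<delta> ^ Suc m \<le> \<delta> / r * r ^ Suc m" .
      moreover have "cmod (monomial n \<alpha> (\<lambda>i. z i - a i)) \<le> \<delta> ^ Suc m"
        unfolding m[symmetric] by (rule norm_monomial_le[OF \<delta>(3)])
      ultimately have "cmod (monomial n \<alpha> (\<lambda>i. z i - a i)) \<le> \<delta> / r * r ^ Suc m" by linarith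
      then have "cmod (c \<alpha>) * cmod (monomial n \<alpha> (\<lambda>i. z i - a i)) \<le> cmod (c \<alpha>) * (\<delta> / r * r ^ Suc m)"
        by (rule mult_left_mono) auto
      then show ?thesis using r by (simp add: m norm_mult mult_ac)
    qed
    have s: "(\<lambda>\<alpha>. \<delta> / r * (cmod (c \<alpha>) * r ^ (\<Sum>i<n. \<alpha> i))) summable_on ?M'"
      by (intro summable_on_cmult_right sum')
    have s': "(\<lambda>\<alpha>. cmod (c \<alpha> * monomial n \<alpha> (\<lambda>i. z i - a i))) summable_on ?M'"
      by (rule summable_on_comparison_test[OF s le]) auto
    have "infsum (\<lambda>\<alpha>. cmod (c \<alpha> * monomial n \<alpha> (\<lambda>i. z i - a i))) ?M' \<le>
        infsum (\<lambda>\<alpha>. \<delta> / r * (cmod (c \<alpha>) * r ^ (\<Sum>i<n. \<alpha> i))) ?M'"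
      by (rule infsum_mono[OF s' s le])
    also have "\<dots> = K * \<delta>" by (subst infsum_cmult_right') (simp add: K_def)
    finally show "\<exists>\<theta>\<le>K * \<delta>. ((\<lambda>\<alpha>. cmod (c \<alpha> * monomial n \<alpha> (\<lambda>i. z i - a i))) has_sum \<theta>) ?M'"
      using has_sum_infsum[OF s'] by blast
  qed (use r in auto)
qed

lemma power_series_at_lipschitz:
  assumes "power_series_at n f a" "a \<in> topspace (complex_space n)"
  obtains r K where "0 < r" "0 \<le> K"
    "\<And>z \<delta>. z \<in> topspace (complex_space n) \<Longrightarrow> 0 < \<delta> \<Longrightarrow> \<delta> \<le> r \<Longrightarrow> (\<And>i. i < n \<Longrightarrow> cmod (z i - a i) \<le> \<delta>) \<Longrightarrow>
      cmod (f z - f a) \<le> K * \<delta>"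
proof -
  obtain c r K where *: "0 < r" "0 \<le> K"
    "\<And>z. z \<in> topspace (complex_space n) \<Longrightarrow> (\<And>i. i < n \<Longrightarrow> cmod (z i - a i) \<le> r) \<Longrightarrow>
      ((\<lambda>\<alpha>. c \<alpha> * monomial n \<alpha> (\<lambda>i. z i - a i)) has_sum (f z - f a)) (multi_indices n - {\<lambda>_. 0})"
    "\<And>z \<delta>. z \<in> topspace (complex_space n) \<Longrightarrow> 0 < \<delta> \<Longrightarrow> \<delta> \<le> r \<Longrightarrow> (\<And>i. i < n \<Longrightarrow> cmod (z i - a i) \<le> \<delta>) \<Longrightarrow>
      \<exists>\<theta>\<le>K * \<delta>. ((\<lambda>\<alpha>. cmod (c \<alpha> * monomial n \<alpha> (\<lambda>i. z i - a i))) has_sum \<theta>) (multi_indices n - {\<lambda>_. 0})"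
    by (rule power_series_atE[OF assms]) blast
  show thesis
  proof (rule that[OF *(1,2)])
    fix z \<delta> assume z: "z \<in> topspace (complex_space n)" "0 < \<delta>" "\<delta> \<le> r" "\<And>i. i < n \<Longrightarrow> cmod (z i - a i) \<le> \<delta>"
    obtain \<theta> where \<theta>: "\<theta> \<le> K * \<delta>"
      "((\<lambda>\<alpha>. cmod (c \<alpha> * monomial n \<alpha> (\<lambda>i. z i - a i))) has_sum \<theta>) (multi_indices n - {\<lambda>_. 0})"
      using *(4)[OF z] by blast
    have "cmod (z i - a i) \<le> r" if "i < n" for i using z(3) z(4)[OF that] by linarith
    from norm_has_sum_bound[OF \<theta>(2) *(3)[OF z(1) this]] \<theta>(1)
    show "cmod (f z - f a) \<le> K * \<delta>" by simp
  qed
qed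

text \<open>Write \<open>f = f a * (1 - q)\<close> and expand \<open>1 / (1 - q)\<close>. For a list
  of nonzero multi-indices, the product of the corresponding terms of \<open>q\<close> is a
  coefficient times the monomial whose exponent is the sum of the list.\<close>

lemma power_series_at_inverse:
  assumes "power_series_at n f a" "a \<in> topspace (complex_space n)" "f a \<noteq> 0"
  shows "power_series_at n (\<lambda>z. inverse (f z)) a"
proof -
  let ?M' = "multi_indices n - {\<lambda>_. 0}"
  obtain c r K where *: "0 < r" "0 \<le> K"
    "\<And>z. z \<in> topspace (complex_space n) \<Longrightarrow> (\<And>i. i < n \<Longrightarrow> cmod (z i - a i) \<le> r) \<Longrightarrow>
      ((\<lambda>\<alpha>. c \<alpha> * monomial n \<alpha> (\<lambda>i. z i - a i)) has_sum (f z - f a)) ?M'"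
    "\<And>z \<delta>. z \<in> topspace (complex_space n) \<Longrightarrow> 0 < \<delta> \<Longrightarrow> \<delta> \<le> r \<Longrightarrow> (\<And>i. i < n \<Longrightarrow> cmod (z i - a i) \<le> \<delta>) \<Longrightarrow>
      \<exists>\<theta>\<le>K * \<delta>. ((\<lambda>\<alpha>. cmod (c \<alpha> * monomial n \<alpha> (\<lambda>i. z i - a i))) has_sum \<theta>) ?M'"
    by (rule power_series_atE[OF assms(1,2)]) blast
  \<comment> \<open>The second bound gives \<open>K * \<delta> < cmod (f a)\<close>, so the norms of
    the terms of \<open>q\<close> add up to less than 1. Using \<open>K + 1\<close> keeps the
    denominator positive.\<close>
  define \<delta> where "\<delta> = min r (cmod (f a) / (2 * (K + 1)))"
  have \<delta>: "0 < \<delta>" "\<delta> \<le> r" using * assms(3) by (auto simp: \<delta>_def)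
  have "K * \<delta> \<le> K * (cmod (f a) / (2 * (K + 1)))" using *(2) by (intro mult_left_mono) (auto simp: \<delta>_def)
  also have "\<dots> < cmod (f a)" using *(2) assms(3) by (simp add: field_simps add_nonneg_pos)
  finally have K\<delta>: "K * \<delta> < cmod (f a)" .
  \<comment> \<open>Off the zero multi-index these are the coefficients of \<open>q\<close>.\<close>
  define b where "b \<alpha> = - c \<alpha> / f a" for \<alpha>
  show ?thesis
  proof (rule power_series_atI[of \<delta> "\<lambda>xs i. \<Sum>\<alpha>\<leftarrow>xs. \<alpha> i" "lists ?M'" _ _
        "\<lambda>xs. inverse (f a) * prod_list (map b xs)"])
    show "(\<lambda>xs i. \<Sum>\<alpha>\<leftarrow>xs. \<alpha> i) ` lists ?M' \<subseteq> multi_indices n"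
      by (force simp: multi_indices_def)
    fix z assume z: "z \<in> topspace (complex_space n)" "\<And>i. i < n \<Longrightarrow> cmod (z i - a i) < \<delta>"
    define h where "h = (\<lambda>\<alpha>. b \<alpha> * monomial n \<alpha> (\<lambda>i. z i - a i))"
    have le: "cmod (z i - a i) \<le> \<delta>" "cmod (z i - a i) \<le> r" if "i < n" for i
      using z(2)[OF that] \<delta>(2) by linarith+
    obtain \<theta> where \<theta>: "\<theta> \<le> K * \<delta>"
      "((\<lambda>\<alpha>. cmod (c \<alpha> * monomial n \<alpha> (\<lambda>i. z i - a i))) has_sum \<theta>) ?M'"
      using *(4)[OF z(1) \<delta> le(1)] by blast
    have "((\<lambda>\<alpha>. inverse (cmod (f a)) * cmod (c \<alpha> * monomial n \<alpha> (\<lambda>i. z i - a i))) has_sum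
        inverse (cmod (f a)) * \<theta>) ?M'"
      by (rule has_sum_cmult_right[OF \<theta>(2)])
    then have "((\<lambda>\<alpha>. cmod (h \<alpha>)) has_sum inverse (cmod (f a)) * \<theta>) ?M'"
      by (simp add: h_def b_def norm_mult norm_divide norm_inverse divide_inverse mult_ac)
    moreover have "inverse (cmod (f a)) * \<theta> < 1"
      using \<theta>(1) K\<delta> assms(3) by (simp add: field_simps)
    moreover have "(h has_sum (- inverse (f a) * (f z - f a))) ?M'"
    proof -
      have "((\<lambda>\<alpha>. - inverse (f a) * (c \<alpha> * monomial n \<alpha> (\<lambda>i. z i - a i))) has_sum
          - inverse (f a) * (f z - f a)) ?M'"
        by (rule has_sum_cmult_right[OF *(3)[OF z(1) le(2)]])
      then show ?thesis by (simp add: h_def b_def divide_inverse mult_ac)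
    qed
    ultimately have "((\<lambda>xs. prod_list (map h xs)) has_sum inverse (1 - (- inverse (f a) * (f z - f a)))) (lists ?M')"
      by (intro has_sum_geometric_lists)
    then have "((\<lambda>xs. inverse (f a) * prod_list (map h xs)) has_sum
        inverse (f a) * inverse (1 - (- inverse (f a) * (f z - f a)))) (lists ?M')"
      by (rule has_sum_cmult_right)
    moreover have "inverse (f a) * inverse (1 - (- inverse (f a) * (f z - f a))) = inverse (f z)"
      using assms(3) by (simp add: field_simps)
    moreover have "prod_list (map h xs) = prod_list (map b xs) * monomial n (\<lambda>i. \<Sum>\<alpha>\<leftarrow>xs. \<alpha> i) (\<lambda>i. z i - a i)" for xs
      by (induction xs) (auto simp: h_def monomial_add mult_ac)
    ultimately show "((\<lambda>xs. inverse (f a) * prod_list (map b xs) * monomial n (\<lambda>i. \<Sum>\<alpha>\<leftarrow>xs. \<alpha> i) (\<lambda>i. z i - a i))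
        has_sum inverse (f z)) (lists ?M')"
      by (simp add: mult_ac)
  qed (rule \<delta>)
qed

section \<open>Homogeneous expansions and restriction to lines\<close>

lemma finite_multi_indices_degree: "finite {\<alpha> \<in> multi_indices n. (\<Sum>i<n. \<alpha> i) = j}"
proof (rule finite_subset)
  show "{\<alpha> \<in> multi_indices n. (\<Sum>i<n. \<alpha> i) = j} \<subseteq>
      {\<alpha>. \<forall>i. (i \<in> {..<n} \<longrightarrow> \<alpha> i \<in> {..j}) \<and> (i \<notin> {..<n} \<longrightarrow> \<alpha> i = 0)}"
    by (auto simp: multi_indices_def intro: member_le_sum)
qed (intro finite_set_of_finite_funs; simp)

lemma power_series_at_homogeneous:
  assumes "power_series_at n f a" "a \<in> topspace (complex_space n)"
  obtains P r where "0 < r" "\<And>j. homogeneous_polynomial n j (P j)"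
    "\<And>z. z \<in> polydisc n r \<Longrightarrow> (\<lambda>j. P j z) sums f (\<lambda>i. a i + z i)"
proof -
  let ?D = "\<lambda>j. {\<alpha> \<in> multi_indices n. (\<Sum>i<n. \<alpha> i) = j}"
  obtain c r where "r > 0" and c: "\<And>z. z \<in> topspace (complex_space n) \<Longrightarrow> (\<forall>i<n. cmod (z i - a i) < r) \<Longrightarrow>
       ((\<lambda>\<alpha>. c \<alpha> * monomial n \<alpha> (\<lambda>i. z i - a i)) has_sum (f z)) (multi_indices n)"
    using assms(1) unfolding power_series_at_def by blast
  show thesis
  proof (rule that[OF \<open>r > 0\<close>, of "\<lambda>j z. \<Sum>\<alpha>\<in>?D j. c \<alpha> * monomial n \<alpha> z"])
    show "homogeneous_polynomial n j (\<lambda>z. \<Sum>\<alpha>\<in>?D j. c \<alpha> * monomial n \<alpha> z)" for j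
      by (auto simp: homogeneous_polynomial_def)
    fix z assume z: "z \<in> polydisc n r"
    have "((\<lambda>\<alpha>. c \<alpha> * monomial n \<alpha> (\<lambda>i. (a i + z i) - a i)) has_sum f (\<lambda>i. a i + z i)) (multi_indices n)"
      by (rule c) (use z assms(2) in \<open>auto simp: polydisc_def topspace_complex_space\<close>)
    then have "((\<lambda>\<alpha>. (c \<alpha> * monomial n \<alpha> z) * 1) has_sum f (\<lambda>i. a i + z i)) (multi_indices n)" by simp
    \<comment> \<open>With \<open>m\<close> constantly 1, the fibres of the total degree are finite
      and their sums are the homogeneous parts.\<close>
    from has_sum_fibres[where m = "\<lambda>_. 1" and expo = "\<lambda>\<alpha>. \<Sum>i<n. \<alpha> i" and J = UNIV, OF _ this]
    show "(\<lambda>j. \<Sum>\<alpha>\<in>?D j. c \<alpha> * monomial n \<alpha> z) sums f (\<lambda>i. a i + z i)"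
      by (simp add: infsum_finite[OF finite_multi_indices_degree] has_sum_imp_sums)
  qed
qed

lemma homogeneous_polynomial_scale:
  assumes "homogeneous_polynomial n j P"
  shows "P (\<lambda>i. t * z i) = t ^ j * P z"
  using assms
  by (auto simp: homogeneous_polynomial_def monomial_scale sum_distrib_left mult_ac intro!: sum.cong)

lemma homogeneous_polynomial_trunc_at:
  assumes "homogeneous_polynomial n j P"
  shows "P (trunc_at n z) = P z"
proof -
  have "monomial n \<alpha> (trunc_at n z) = monomial n \<alpha> z" for \<alpha>
    by (rule monomial_cong) (simp add: trunc_at_def)
  then show ?thesis using assms by (auto simp: homogeneous_polynomial_def)
qed

lemma scale_in_polydisc:
  assumes "v \<in> topspace (complex_space n)" "0 < r"
  obtains \<rho> where "0 < \<rho>" "\<And>s. cmod s < \<rho> \<Longrightarrow> (\<lambda>i. s * v i) \<in> polydisc n r"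
proof
  define B where "B = (\<Sum>i<n. cmod (v i))"
  have B: "0 \<le> B" by (simp add: B_def sum_nonneg)
  show "0 < r / (B + 1)" using assms(2) B by simp
  fix s assume s: "cmod s < r / (B + 1)"
  have "cmod (s * v i) < r" if "i < n" for i
  proof -
    have "cmod (v i) \<le> B" unfolding B_def using that by (intro member_le_sum) auto
    then have "cmod (s * v i) \<le> cmod s * (B + 1)" by (auto simp: norm_mult intro: mult_left_mono)
    also have "\<dots> < r" using s B by (simp add: field_simps)
    finally show ?thesis .
  qed
  then show "(\<lambda>i. s * v i) \<in> polydisc n r"
    using assms(1) by (auto simp: polydisc_def topspace_complex_space)
qed

text \<open>By homogeneity \<open>P j (s v) = s ^ j * P j v\<close>, so on a complex line the
  expansion is a power series in the single variable \<open>s\<close>, and one-variable theory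
  applies.\<close>

lemma power_series_at_field_differentiable_line:
  assumes "power_series_at n f a" "a \<in> topspace (complex_space n)" "v \<in> topspace (complex_space n)"
  shows "(\<lambda>s. f (\<lambda>i. a i + s * v i)) field_differentiable (at 0)"
proof -
  obtain P r where P: "0 < r" "\<And>j. homogeneous_polynomial n j (P j)"
    "\<And>z. z \<in> polydisc n r \<Longrightarrow> (\<lambda>j. P j z) sums f (\<lambda>i. a i + z i)"
    by (rule power_series_at_homogeneous[OF assms(1,2)]) blast
  obtain \<rho> where \<rho>: "0 < \<rho>" "\<And>s. cmod s < \<rho> \<Longrightarrow> (\<lambda>i. s * v i) \<in> polydisc n r"
    by (rule scale_in_polydisc[OF assms(3) P(1)]) blast
  have "(\<lambda>s. f (\<lambda>i. a i + s * v i)) holomorphic_on ball 0 \<rho>"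
  proof (rule power_series_holomorphic[where a = "\<lambda>j. P j v"])
    fix s assume "s \<in> ball (0::complex) \<rho>"
    with P(3)[OF \<rho>(2)[of s]] show "(\<lambda>j. P j v * (s - 0) ^ j) sums f (\<lambda>i. a i + s * v i)"
      by (simp add: homogeneous_polynomial_scale[OF P(2)] mult_ac)
  qed
  then show ?thesis
    using \<rho>(1) by (simp add: holomorphic_on_imp_differentiable_at)
qed

section \<open>Initial forms as limits along lines\<close>

lemma holomorphic_germ_homogeneous_expansion:
  assumes "holomorphic_germ n f"
  obtains P where "homogeneous_expansion n f P"
proof -
  have "power_series_at n f origin"
    using assms origin_in_polydisc by (auto simp: holomorphic_germ_iff)
  then obtain P r where "0 < r" "\<And>j. homogeneous_polynomial n j (P j)"
    "\<And>z. z \<in> polydisc n r \<Longrightarrow> (\<lambda>j. P j z) sums f (\<lambda>i. origin i + z i)"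
    by (rule power_series_at_homogeneous[OF _ origin_in_complex_space]) blast
  then show thesis
    by (intro that[of P]) (auto simp: homogeneous_expansion_def eventually_nhdsin_complex_space)
qed

lemma homogeneous_expansion_line:
  assumes "homogeneous_expansion n f P" "v \<in> topspace (complex_space n)"
  obtains \<rho> where "0 < \<rho>" "\<And>t. cmod t < \<rho> \<Longrightarrow> (\<lambda>j. P j v * t ^ j) sums f (\<lambda>i. t * v i)"
proof -
  obtain r where r: "0 < r" "\<And>z. z \<in> polydisc n r \<Longrightarrow> (\<lambda>j. P j z) sums f z"
    and P: "\<And>j. homogeneous_polynomial n j (P j)"
    using assms(1) by (auto simp: homogeneous_expansion_def eventually_nhdsin_complex_space)
  obtain \<rho> where \<rho>: "0 < \<rho>" "\<And>s. cmod s < \<rho> \<Longrightarrow> (\<lambda>i. s * v i) \<in> polydisc n r"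
    by (rule scale_in_polydisc[OF assms(2) r(1)]) blast
  show thesis
  proof (rule that[OF \<rho>(1)])
    fix t assume "cmod t < \<rho>"
    from r(2)[OF \<rho>(2)[OF this]] show "(\<lambda>j. P j v * t ^ j) sums f (\<lambda>i. t * v i)"
      by (simp add: homogeneous_polynomial_scale[OF P] mult_ac)
  qed
qed

lemma tendsto_homogeneous_expansion:
  assumes "homogeneous_expansion n f P" "v \<in> topspace (complex_space n)" "\<And>j. j < e \<Longrightarrow> P j v = 0"
  shows "((\<lambda>t. f (\<lambda>i. t * v i) / t ^ e) \<longlongrightarrow> P e v) (at 0)"
proof -
  obtain \<rho> where \<rho>: "0 < \<rho>" "\<And>t. cmod t < \<rho> \<Longrightarrow> (\<lambda>j. P j v * t ^ j) sums f (\<lambda>i. t * v i)"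
    by (rule homogeneous_expansion_line[OF assms(1,2)]) blast
  have "((\<lambda>t. f (\<lambda>i. t * v i) / t ^ e) \<longlongrightarrow> (\<lambda>j. P (j + e) v) 0) (at 0)"
  proof (rule powser_limit_0_strong[OF \<rho>(1)])
    fix t :: complex assume t: "t \<noteq> 0" "norm t < \<rho>"
    have "(\<lambda>j. P (j + e) v * t ^ (j + e)) sums (f (\<lambda>i. t * v i) - (\<Sum>j<e. P j v * t ^ j))"
      by (rule sums_split_initial_segment[OF \<rho>(2)[OF t(2)]])
    then have "(\<lambda>j. P (j + e) v * t ^ (j + e) / t ^ e) sums (f (\<lambda>i. t * v i) / t ^ e)"
      using sums_divide assms(3) by fastforce
    then show "(\<lambda>j. P (j + e) v * t ^ j) sums (f (\<lambda>i. t * v i) / t ^ e)"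
      using t(1) by (simp add: power_add)
  qed
  then show ?thesis by simp
qed

text \<open>If the parts below degree \<open>j\<close> vanish at \<open>v\<close>, then
  \<open>f (t v) / t ^ j\<close> tends to \<open>P j v\<close>. It is also the convergent quotient
  by \<open>t ^ e\<close> times \<open>t ^ (e - j)\<close>, so it tends to 0.\<close>

lemma homogeneous_expansion_vanishing:
  assumes "homogeneous_expansion n f P" "v \<in> topspace (complex_space n)"
    and "((\<lambda>t. f (\<lambda>i. t * v i) / t ^ e) \<longlongrightarrow> R) (at 0)"
  shows "j < e \<Longrightarrow> P j v = 0"
proof (induction j rule: less_induct)
  case (less j)
  have "((\<lambda>t. f (\<lambda>i. t * v i) / t ^ j) \<longlongrightarrow> P j v) (at 0)"
    using less by (intro tendsto_homogeneous_expansion[OF assms(1,2)]) auto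
  moreover have "((\<lambda>t. f (\<lambda>i. t * v i) / t ^ e * t ^ (e - j)) \<longlongrightarrow> R * 0 ^ (e - j)) (at 0)"
    by (intro tendsto_mult assms(3) tendsto_power tendsto_ident_at)
  then have "((\<lambda>t. f (\<lambda>i. t * v i) / t ^ e * t ^ (e - j)) \<longlongrightarrow> 0) (at 0)"
    using less.prems by (simp add: zero_power)
  then have "((\<lambda>t. f (\<lambda>i. t * v i) / t ^ j) \<longlongrightarrow> 0) (at 0)"
  proof (rule Lim_transform_within[OF _ zero_less_one])
    show "f (\<lambda>i. t * v i) / t ^ e * t ^ (e - j) = f (\<lambda>i. t * v i) / t ^ j" if "0 < dist t 0" for t
      using that less.prems by (simp add: power_diff)
  qed
  ultimately show ?case
    by (rule tendsto_unique[OF at_neq_bot])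
qed

lemma homogeneous_expansion_limit:
  assumes "homogeneous_expansion n f P" "v \<in> topspace (complex_space n)"
    and "((\<lambda>t. f (\<lambda>i. t * v i) / t ^ e) \<longlongrightarrow> R) (at 0)"
  shows "P e v = R"
proof (rule tendsto_unique[OF at_neq_bot _ assms(3)])
  show "((\<lambda>t. f (\<lambda>i. t * v i) / t ^ e) \<longlongrightarrow> P e v) (at 0)"
    by (rule tendsto_homogeneous_expansion[OF assms(1,2)]) (rule homogeneous_expansion_vanishing[OF assms])
qed

text \<open>Along each line the coefficients are recovered one at a time: subtract the lower terms,
  on which both expansions agree by induction, divide by \<open>t ^ j\<close> and let
  \<open>t\<close> tend to 0. Values at sequences outside C^n follow by truncation.\<close>

lemma homogeneous_expansion_unique:
  assumes P: "homogeneous_expansion n f P" and Q: "homogeneous_expansion n f Q"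
  shows "P = Q"
proof (intro ext)
  fix j z
  have "P j v = Q j v" if v: "v \<in> topspace (complex_space n)" for v
  proof (induction j rule: less_induct)
    case (less j)
    obtain \<rho> where \<rho>: "0 < \<rho>" "\<And>t. cmod t < \<rho> \<Longrightarrow> (\<lambda>j. P j v * t ^ j) sums f (\<lambda>i. t * v i)"
      by (rule homogeneous_expansion_line[OF P v]) blast
    obtain \<sigma> where \<sigma>: "0 < \<sigma>" "\<And>t. cmod t < \<sigma> \<Longrightarrow> (\<lambda>j. Q j v * t ^ j) sums f (\<lambda>i. t * v i)"
      by (rule homogeneous_expansion_line[OF Q v]) blast
    define S where "S = (\<lambda>t. \<Sum>i<j. P i v * t ^ i)"
    have lim: "((\<lambda>t. (f (\<lambda>i. t * v i) - S t) / t ^ j) \<longlongrightarrow> (\<lambda>i. R (i + j) v) 0) (at 0)"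
      if R: "\<And>t. cmod t < \<tau> \<Longrightarrow> (\<lambda>j. R j v * t ^ j) sums f (\<lambda>i. t * v i)" "0 < \<tau>"
        "\<And>i. i < j \<Longrightarrow> R i v = P i v" for R :: "nat \<Rightarrow> (nat \<Rightarrow> complex) \<Rightarrow> complex" and \<tau>
    proof (rule powser_limit_0_strong[OF R(2)])
      fix t :: complex assume t: "t \<noteq> 0" "norm t < \<tau>"
      have "(\<lambda>i. R (i + j) v * t ^ (i + j)) sums (f (\<lambda>i. t * v i) - (\<Sum>i<j. R i v * t ^ i))"
        by (rule sums_split_initial_segment[OF R(1)[OF t(2)]])
      then have "(\<lambda>i. R (i + j) v * t ^ (i + j)) sums (f (\<lambda>i. t * v i) - S t)"
        using R(3) by (simp add: S_def)
      then have "(\<lambda>i. R (i + j) v * t ^ (i + j) / t ^ j) sums ((f (\<lambda>i. t * v i) - S t) / t ^ j)"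
        by (rule sums_divide)
      then show "(\<lambda>i. R (i + j) v * t ^ i) sums ((f (\<lambda>i. t * v i) - S t) / t ^ j)"
        using t(1) by (simp add: power_add)
    qed
    have "((\<lambda>t. (f (\<lambda>i. t * v i) - S t) / t ^ j) \<longlongrightarrow> P j v) (at 0)"
      using lim[of \<rho> P] \<rho> by simp
    moreover have "((\<lambda>t. (f (\<lambda>i. t * v i) - S t) / t ^ j) \<longlongrightarrow> Q j v) (at 0)"
      using lim[of \<sigma> Q] \<sigma> less.IH by simp
    ultimately show ?case by (rule tendsto_unique[OF at_neq_bot])
  qed
  moreover have "homogeneous_polynomial n j (P j)" "homogeneous_polynomial n j (Q j)"
    using P Q by (simp_all add: homogeneous_expansion_def)
  ultimately show "P j z = Q j z"
    using homogeneous_polynomial_trunc_at trunc_at_in_complex_space by metis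
qed

lemma homogeneous_part_eq: "homogeneous_expansion n f P \<Longrightarrow> homogeneous_part n f = P"
  unfolding homogeneous_part_def using homogeneous_expansion_unique by blast

text \<open>Reads order and initial form off limits along complex lines, so no expansion has to be
  computed for the comparison germs. The limits force all parts below degree \<open>e\<close> to
  vanish, and \<open>v\<close> shows that the part of degree \<open>e\<close> does not.\<close>

lemma germ_order_initial_form_eq:
  assumes "holomorphic_germ n f" "v \<in> topspace (complex_space n)" "R v \<noteq> 0"
    and lim: "\<And>z. z \<in> topspace (complex_space n) \<Longrightarrow> ((\<lambda>t. f (\<lambda>i. t * z i) / t ^ e) \<longlongrightarrow> R z) (at 0)"
  shows "germ_order n f = e" "z \<in> topspace (complex_space n) \<Longrightarrow> initial_form n f z = R z"
proof -
  obtain P where P: "homogeneous_expansion n f P"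
    by (rule holomorphic_germ_homogeneous_expansion[OF assms(1)])
  have hom: "homogeneous_polynomial n j (P j)" for j
    using P by (simp add: homogeneous_expansion_def)
  show order: "germ_order n f = e"
    unfolding germ_order_def homogeneous_part_eq[OF P]
  proof (rule Least_equality)
    show "P e \<noteq> (\<lambda>_. 0)"
      using homogeneous_expansion_limit[OF P assms(2) lim[OF assms(2)]] assms(3) by auto
    fix j assume j: "P j \<noteq> (\<lambda>_. 0)"
    show "e \<le> j"
    proof (rule ccontr)
      assume "\<not> e \<le> j"
      then have "P j (trunc_at n z) = 0" for z
        by (intro homogeneous_expansion_vanishing[OF P _ lim]) auto
      then have "P j z = 0" for z
        by (simp add: homogeneous_polynomial_trunc_at[OF hom])
      with j show False by auto
    qed
  qed
  show "z \<in> topspace (complex_space n) \<Longrightarrow> initial_form n f z = R z"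
    unfolding initial_form_def order homogeneous_part_eq[OF P]
    by (rule homogeneous_expansion_limit[OF P _ lim])
qed

lemma initial_form_properties:
  assumes "holomorphic_germ n f" "\<not> germ_eq n f (\<lambda>_. 0)"
  shows "z \<in> topspace (complex_space n) \<Longrightarrow>
      ((\<lambda>t. f (\<lambda>i. t * z i) / t ^ germ_order n f) \<longlongrightarrow> initial_form n f z) (at 0)"
    and "homogeneous_polynomial n (germ_order n f) (initial_form n f)"
    and "\<exists>v\<in>topspace (complex_space n). initial_form n f v \<noteq> 0"
proof -
  obtain P where P: "homogeneous_expansion n f P"
    by (rule holomorphic_germ_homogeneous_expansion[OF assms(1)])
  have hom: "homogeneous_polynomial n j (P j)" for j
    using P by (simp add: homogeneous_expansion_def)
  have "\<exists>j. P j \<noteq> (\<lambda>_. 0)"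
  proof (rule ccontr)
    assume "\<nexists>j. P j \<noteq> (\<lambda>_. 0)"
    then have "P j z = 0" for j z by (metis (no_types))
    moreover obtain r where "0 < r" "\<And>z. z \<in> polydisc n r \<Longrightarrow> (\<lambda>j. P j z) sums f z"
      using P by (auto simp: homogeneous_expansion_def eventually_nhdsin_complex_space)
    ultimately have "0 < r" "\<And>z. z \<in> polydisc n r \<Longrightarrow> f z = 0"
      by (simp, metis sums_0 sums_unique2)
    then have "germ_eq n f (\<lambda>_. 0)"
      unfolding germ_eq_iff by (intro exI[of _ r]) auto
    with assms(2) show False by simp
  qed
  then have ne: "P (germ_order n f) \<noteq> (\<lambda>_. 0)"
    unfolding germ_order_def homogeneous_part_eq[OF P] by (rule LeastI_ex)
  have zero: "P j = (\<lambda>_. 0)" if "j < germ_order n f" for j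
    using not_less_Least[of j "\<lambda>m. P m \<noteq> (\<lambda>_. 0)"] that
    unfolding germ_order_def homogeneous_part_eq[OF P] by simp
  have eq: "initial_form n f = P (germ_order n f)"
    by (simp add: initial_form_def homogeneous_part_eq[OF P])
  show "homogeneous_polynomial n (germ_order n f) (initial_form n f)"
    by (simp add: eq hom)
  show "z \<in> topspace (complex_space n) \<Longrightarrow>
      ((\<lambda>t. f (\<lambda>i. t * z i) / t ^ germ_order n f) \<longlongrightarrow> initial_form n f z) (at 0)"
    unfolding eq by (rule tendsto_homogeneous_expansion[OF P]) (simp_all add: zero)
  obtain z where "initial_form n f z \<noteq> 0" using ne by (auto simp: eq)
  then have "initial_form n f (trunc_at n z) \<noteq> 0"
    by (simp add: eq homogeneous_polynomial_trunc_at[OF hom])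
  then show "\<exists>v\<in>topspace (complex_space n). initial_form n f v \<noteq> 0"
    using trunc_at_in_complex_space by blast
qed

section \<open>Reduced germs\<close>

lemma holomorphic_germ_common_polydisc:
  assumes "holomorphic_germ n f" "holomorphic_germ n g"
  obtains r where "0 < r" "\<And>a. a \<in> polydisc n r \<Longrightarrow> power_series_at n f a"
    "\<And>a. a \<in> polydisc n r \<Longrightarrow> power_series_at n g a"
proof -
  obtain r s where "0 < r" "\<forall>a\<in>polydisc n r. power_series_at n f a"
    and "0 < s" "\<forall>a\<in>polydisc n s. power_series_at n g a"
    using assms by (auto simp: holomorphic_germ_iff)
  then show thesis
    using polydisc_mono[of "min r s" r n] polydisc_mono[of "min r s" s n] by (intro that[of "min r s"]) auto
qed

lemma holomorphic_germ_add:
  assumes "holomorphic_germ n f" "holomorphic_germ n g"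
  shows "holomorphic_germ n (\<lambda>z. f z + g z)"
proof -
  obtain r where "0 < r" "\<And>a. a \<in> polydisc n r \<Longrightarrow> power_series_at n f a"
    "\<And>a. a \<in> polydisc n r \<Longrightarrow> power_series_at n g a"
    by (rule holomorphic_germ_common_polydisc[OF assms]) blast
  then show ?thesis
    unfolding holomorphic_germ_iff by (intro exI[of _ r]) (auto intro: power_series_at_add)
qed

lemma holomorphic_germ_mult:
  assumes "holomorphic_germ n f" "holomorphic_germ n g"
  shows "holomorphic_germ n (\<lambda>z. f z * g z)"
proof -
  obtain r where "0 < r" "\<And>a. a \<in> polydisc n r \<Longrightarrow> power_series_at n f a"
    "\<And>a. a \<in> polydisc n r \<Longrightarrow> power_series_at n g a"
    by (rule holomorphic_germ_common_polydisc[OF assms]) blast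
  then show ?thesis
    unfolding holomorphic_germ_iff by (intro exI[of _ r]) (auto intro: power_series_at_mult)
qed

lemma holomorphic_germ_power:
  "holomorphic_germ n f \<Longrightarrow> holomorphic_germ n (\<lambda>z. f z ^ k)"
  unfolding holomorphic_germ_iff using power_series_at_power by blast

lemma holomorphic_germ_coordinate: "j < n \<Longrightarrow> holomorphic_germ n (\<lambda>z. z j)"
  unfolding holomorphic_germ_iff by (intro exI[of _ 1]) (auto intro: power_series_at_coordinate)

lemma holomorphic_germ_trunc_at:
  assumes "holomorphic_germ n f" "n \<le> N"
  shows "holomorphic_germ N (\<lambda>z. f (trunc_at n z))"
proof -
  obtain r where "0 < r" "\<And>a. a \<in> polydisc n r \<Longrightarrow> power_series_at n f a"
    using assms(1) by (auto simp: holomorphic_germ_iff)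
  then show ?thesis
    unfolding holomorphic_germ_iff
    by (intro exI[of _ r]) (auto intro!: power_series_at_trunc_at assms(2) trunc_at_in_polydisc)
qed

text \<open>The bound \<open>K * \<delta>\<close> keeps \<open>f\<close> away from 0 on a polydisc,
  and there the pointwise inverse has a power series at every point.\<close>

lemma holomorphic_germ_nonzero_unit:
  assumes "holomorphic_germ n f" "f origin \<noteq> 0"
  shows "germ_unit n f"
proof -
  obtain R where R: "0 < R" "\<And>a. a \<in> polydisc n R \<Longrightarrow> power_series_at n f a"
    using assms(1) by (auto simp: holomorphic_germ_iff)
  obtain r K where K: "0 < r" "0 \<le> K"
    "\<And>z \<delta>. z \<in> topspace (complex_space n) \<Longrightarrow> 0 < \<delta> \<Longrightarrow> \<delta> \<le> r \<Longrightarrow> (\<And>i. i < n \<Longrightarrow> cmod (z i - 0) \<le> \<delta>) \<Longrightarrow>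
      cmod (f z - f origin) \<le> K * \<delta>"
    by (rule power_series_at_lipschitz[OF R(2)[OF origin_in_polydisc[OF R(1)]] origin_in_complex_space]) blast
  define \<delta> where "\<delta> = min (min r R) (cmod (f origin) / (2 * (K + 1)))"
  have \<delta>: "0 < \<delta>" "\<delta> \<le> r" "\<delta> \<le> R" using K R assms(2) by (auto simp: \<delta>_def)
  have "K * \<delta> \<le> K * (cmod (f origin) / (2 * (K + 1)))"
    using K(2) by (intro mult_left_mono) (auto simp: \<delta>_def)
  also have "\<dots> < cmod (f origin)"
    using K(2) assms(2) by (simp add: field_simps add_nonneg_pos)
  finally have K\<delta>: "K * \<delta> < cmod (f origin)" .
  have ne: "f z \<noteq> 0" if "z \<in> polydisc n \<delta>" for z
  proof
    assume "f z = 0"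
    moreover have "cmod (f z - f origin) \<le> K * \<delta>"
      using that \<delta> by (intro K(3)) (auto simp: polydisc_def)
    ultimately show False using K\<delta> by simp
  qed
  have "holomorphic_germ n (\<lambda>z. inverse (f z))"
    unfolding holomorphic_germ_iff
    using ne \<delta>(1,3) polydisc_mono[OF \<delta>(3)] polydisc_subset
    by (intro exI[of _ \<delta>]) (auto intro!: power_series_at_inverse R(2))
  moreover have "germ_eq n (\<lambda>_. 1) (\<lambda>z. f z * inverse (f z))"
    unfolding germ_eq_iff using ne \<delta>(1) by (intro exI[of _ \<delta>]) auto
  ultimately show ?thesis
    using assms(1) unfolding germ_unit_def germ_dvd_def by blast
qed

text \<open>Stated along a parametrisation \<open>\<gamma>\<close>, to be used for compactness with
  parameters \<open>(s, w)\<close> in C x C and for a limit in the single parameter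
  \<open>s\<close>.\<close>

lemma power_series_at_continuous_compose:
  fixes \<gamma> :: "'b::metric_space \<Rightarrow> nat \<Rightarrow> complex"
  assumes "power_series_at n f (\<gamma> x)" "\<And>y. \<gamma> y \<in> topspace (complex_space n)"
    and cont: "\<And>i. i < n \<Longrightarrow> continuous (at x within S) (\<lambda>y. \<gamma> y i)"
  shows "continuous (at x within S) (\<lambda>y. f (\<gamma> y))"
  unfolding continuous_within tendsto_iff
proof (intro allI impI)
  fix e :: real assume "0 < e"
  obtain r K where K: "0 < r" "0 \<le> K"
    "\<And>z \<delta>. z \<in> topspace (complex_space n) \<Longrightarrow> 0 < \<delta> \<Longrightarrow> \<delta> \<le> r \<Longrightarrow> (\<And>i. i < n \<Longrightarrow> cmod (z i - \<gamma> x i) \<le> \<delta>) \<Longrightarrow>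
      cmod (f z - f (\<gamma> x)) \<le> K * \<delta>"
    by (rule power_series_at_lipschitz[OF assms(1,2)]) blast
  define \<delta> where "\<delta> = min r (e / (2 * (K + 1)))"
  have \<delta>: "0 < \<delta>" "\<delta> \<le> r" using K \<open>0 < e\<close> by (auto simp: \<delta>_def)
  have "K * \<delta> \<le> K * (e / (2 * (K + 1)))" using K(2) by (intro mult_left_mono) (auto simp: \<delta>_def)
  also have "\<dots> < e" using K(2) \<open>0 < e\<close> by (simp add: field_simps add_nonneg_pos)
  finally have K\<delta>: "K * \<delta> < e" .
  have "eventually (\<lambda>y. \<forall>i\<in>{..<n}. dist (\<gamma> y i) (\<gamma> x i) < \<delta>) (at x within S)"
    using cont \<delta>(1) by (intro eventually_ball_finite) (auto simp: continuous_within tendsto_iff)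
  then show "eventually (\<lambda>y. dist (f (\<gamma> y)) (f (\<gamma> x)) < e) (at x within S)"
  proof (rule eventually_mono)
    fix y assume "\<forall>i\<in>{..<n}. dist (\<gamma> y i) (\<gamma> x i) < \<delta>"
    then have "cmod (f (\<gamma> y) - f (\<gamma> x)) \<le> K * \<delta>"
      by (intro K(3) assms(2) \<delta>) (auto simp: dist_norm less_imp_le)
    with K\<delta> show "dist (f (\<gamma> y)) (f (\<gamma> x)) < e" by (simp add: dist_norm)
  qed
qed

section \<open>Slices in the last variable, and reducedness of A + w^d\<close>

definition extend_point :: "nat \<Rightarrow> (nat \<Rightarrow> complex) \<Rightarrow> complex \<Rightarrow> nat \<Rightarrow> complex"
  where "extend_point n x w = (\<lambda>i. if i < n then x i else if i = n then w else 0)"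

lemma extend_point_in_complex_space [simp]: "extend_point n x w \<in> topspace (complex_space (Suc n))"
  by (auto simp: extend_point_def topspace_complex_space)

lemma trunc_at_extend_point [simp]: "trunc_at n (extend_point n x w) = trunc_at n x"
  by (auto simp: extend_point_def trunc_at_def)

lemma extend_point_last [simp]: "extend_point n x w n = w"
  by (simp add: extend_point_def)

lemma extend_point_in_polydisc:
  "x \<in> polydisc n r \<Longrightarrow> cmod w < r \<Longrightarrow> extend_point n x w \<in> polydisc (Suc n) r"
  by (auto simp: polydisc_def less_Suc_eq) (auto simp: extend_point_def)

text \<open>The derivative at \<open>w\<close> is the derivative at 0 along the line through
  \<open>extend_point n x w\<close> in the direction of the last unit vector.\<close>

lemma power_series_at_field_differentiable_last:
  assumes "power_series_at (Suc n) p (extend_point n x w)"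
  shows "(\<lambda>w. p (extend_point n x w)) field_differentiable (at w)"
proof -
  have "(\<lambda>s. p (\<lambda>i. extend_point n x w i + s * extend_point n origin 1 i)) field_differentiable (at 0)"
    by (rule power_series_at_field_differentiable_line[OF assms]) auto
  also have "(\<lambda>s. p (\<lambda>i. extend_point n x w i + s * extend_point n origin 1 i)) = (\<lambda>s. p (extend_point n x (s + w)))"
    by (intro ext arg_cong[where f = p]) (auto simp: extend_point_def)
  finally show ?thesis
    unfolding field_differentiable_def
    using DERIV_shift[of "\<lambda>w. p (extend_point n x w)" _ 0 w] by auto
qed

text \<open>
  If \<open>A + w^d = p^2 h\<close>, then \<open>p\<close> has no zero with \<open>w \<noteq> 0\<close> or \<open>A \<noteq> 0\<close>, because there
  \<open>A + w^d\<close> has only simple zeros in \<open>w\<close>. Hence \<open>1/p\<close> is holomorphic in \<open>w\<close> on every line with \<open>A \<noteq> 0\<close>, and the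
  maximum principle bounds \<open>p\<close> away from zero on such lines near the origin: \<open>p\<close> is a unit.
\<close>

lemma reduced_germ_add_power:
  assumes A: "holomorphic_germ n A" "A origin = 0" "\<not> germ_eq n A (\<lambda>_. 0)" and "2 \<le> d"
  shows "reduced_germ (Suc n) (\<lambda>z. A (trunc_at n z) + z n ^ d)"
proof -
  define F where "F = (\<lambda>z. A (trunc_at n z) + z n ^ d)"
  let ?pt = "extend_point n"
  have Fpt: "F (?pt x w) = A x + w ^ d" if "x \<in> topspace (complex_space n)" for x w
    using that by (simp add: F_def trunc_at_id)
  have holF: "holomorphic_germ (Suc n) F"
    unfolding F_def
    by (intro holomorphic_germ_add holomorphic_germ_trunc_at holomorphic_germ_power holomorphic_germ_coordinate A(1)) auto
  moreover have "F origin = 0" using A(2) \<open>2 \<le> d\<close> by (simp add: F_def)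
  moreover have "\<not> germ_eq (Suc n) F (\<lambda>_. 0)"
  proof
    assume "germ_eq (Suc n) F (\<lambda>_. 0)"
    then obtain r where r: "0 < r" "\<And>z. z \<in> polydisc (Suc n) r \<Longrightarrow> F z = 0"
      by (auto simp: germ_eq_iff)
    have "F (?pt origin (of_real (r/2))) = 0"
      by (intro r(2) extend_point_in_polydisc origin_in_polydisc) (use r(1) in auto)
    moreover have "F (?pt origin (of_real (r/2))) \<noteq> 0"
      using r(1) A(2) by (subst Fpt) auto
    ultimately show False by contradiction
  qed
  moreover have False if p: "germ_irreducible (Suc n) p" and dvd: "germ_dvd (Suc n) (\<lambda>z. p z * p z) F" for p
  proof -
    obtain h where h: "holomorphic_germ (Suc n) h" "germ_eq (Suc n) F (\<lambda>z. p z * p z * h z)"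
      using dvd by (auto simp: germ_dvd_def)
    have holp: "holomorphic_germ (Suc n) p" and nunit: "\<not> germ_unit (Suc n) p"
      using p by (auto simp: germ_irreducible_def)
    obtain r1 where r1: "0 < r1" "\<And>a. a \<in> polydisc (Suc n) r1 \<Longrightarrow> power_series_at (Suc n) p a"
      "\<And>a. a \<in> polydisc (Suc n) r1 \<Longrightarrow> power_series_at (Suc n) h a"
      by (rule holomorphic_germ_common_polydisc[OF holp h(1)]) blast
    obtain r2 where r2: "0 < r2" "\<And>z. z \<in> polydisc (Suc n) r2 \<Longrightarrow> F z = p z * p z * h z"
      using h(2) by (auto simp: germ_eq_iff)
    define r where "r = min r1 r2"
    have "0 < r" using r1(1) r2(1) by (simp add: r_def)
    have sub: "polydisc (Suc n) r \<subseteq> polydisc (Suc n) r1" "polydisc (Suc n) r \<subseteq> polydisc (Suc n) r2"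
      by (auto simp: r_def intro!: polydisc_mono)
    have pd: "(\<lambda>w. p (?pt x w)) field_differentiable (at w)"
      and hd: "(\<lambda>w. h (?pt x w)) field_differentiable (at w)"
      and eq: "A x + w ^ d = p (?pt x w) * p (?pt x w) * h (?pt x w)"
      if x: "x \<in> polydisc n r" and w: "cmod w < r" for x w
    proof -
      have pt: "?pt x w \<in> polydisc (Suc n) r" by (rule extend_point_in_polydisc[OF x w])
      show "(\<lambda>w. p (?pt x w)) field_differentiable (at w)" "(\<lambda>w. h (?pt x w)) field_differentiable (at w)"
        using pt sub(1) by (auto intro!: power_series_at_field_differentiable_last r1)
      show "A x + w ^ d = p (?pt x w) * p (?pt x w) * h (?pt x w)"
        using r2(2)[of "?pt x w"] pt sub(2) Fpt[OF polydisc_subset[OF x]] by auto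
    qed
    have nz: "p (?pt x w) \<noteq> 0" if x: "x \<in> polydisc n r" and w: "cmod w < r" and "w \<noteq> 0 \<or> A x \<noteq> 0" for x w
    proof
      assume p0: "p (?pt x w) = 0"
      have "A x + w ^ d = 0" using eq[OF x w] p0 by simp
      \<comment> \<open>If \<open>w = 0\<close>, then \<open>w ^ d = 0\<close> and hence
        \<open>A x = 0\<close>, against the assumption.\<close>
      then have "w \<noteq> 0" using that(3) \<open>2 \<le> d\<close> by (auto simp: power_0_left)
      obtain p' where p': "((\<lambda>w. p (?pt x w)) has_field_derivative p') (at w)"
        using pd[OF x w] by (auto simp: field_differentiable_def)
      obtain h' where h': "((\<lambda>w. h (?pt x w)) has_field_derivative h') (at w)"
        using hd[OF x w] by (auto simp: field_differentiable_def)
      \<comment> \<open>Since \<open>p\<close> occurs twice, every summand of the product rule keeps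
        a factor \<open>p\<close>, which is 0 at \<open>w\<close>.\<close>
      have "((\<lambda>w. p (?pt x w) * p (?pt x w) * h (?pt x w)) has_field_derivative 0) (at w)"
        using DERIV_mult[OF DERIV_mult[OF p' p'] h'] p0 by simp
      then have "((\<lambda>w. A x + w ^ d) has_field_derivative 0) (at w)"
      proof (rule has_field_derivative_transform_within_open)
        show "w \<in> ball 0 r" using w by simp
        show "p (?pt x u) * p (?pt x u) * h (?pt x u) = A x + u ^ d" if "u \<in> ball 0 r" for u
          using eq[OF x, of u] that by simp
      qed simp
      moreover have "((\<lambda>w. A x + w ^ d) has_field_derivative of_nat d * w ^ (d - 1)) (at w)"
        by (auto intro!: derivative_eq_intros)
      ultimately have "of_nat d * w ^ (d - 1) = 0"
        by (rule DERIV_unique[symmetric])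
      with \<open>w \<noteq> 0\<close> \<open>2 \<le> d\<close> show False by simp
    qed
    \<comment> \<open>The points \<open>s v\<close> with small \<open>s \<noteq> 0\<close> approach
      the origin and satisfy \<open>A (s v) \<noteq> 0\<close>, because the initial form of
      \<open>A\<close> is nonzero at \<open>v\<close>.\<close>
    obtain v where v: "v \<in> topspace (complex_space n)" "initial_form n A v \<noteq> 0"
      using initial_form_properties(3)[OF A(1,3)] by blast
    obtain \<rho> where \<rho>: "0 < \<rho>" "\<And>s. cmod s < \<rho> \<Longrightarrow> (\<lambda>i. s * v i) \<in> polydisc n r"
      by (rule scale_in_polydisc[OF v(1) \<open>0 < r\<close>]) blast
    have "eventually (\<lambda>t. A (\<lambda>i. t * v i) / t ^ germ_order n A \<noteq> 0) (at 0)"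
      using tendsto_imp_eventually_ne[OF initial_form_properties(1)[OF A(1,3) v(1)] v(2)] .
    then have ev: "eventually (\<lambda>t. A (\<lambda>i. t * v i) \<noteq> 0) (at 0)"
      by (rule eventually_mono) auto
    \<comment> \<open>On the circle \<open>cmod w = r/2\<close> the values of \<open>p\<close> are
      nonzero even where \<open>A (s v) = 0\<close>, in particular for \<open>s = 0\<close>.
      Compactness thus gives a lower bound \<open>c\<close> independent of \<open>s\<close>.\<close>
    let ?K = "cball (0::complex) (\<rho>/2) \<times> sphere (0::complex) (r/2)"
    have contp: "continuous (at y within S) (\<lambda>y. p (?pt (\<lambda>i. fst y * v i) (snd y)))"
      if "cmod (fst y) < \<rho>" "cmod (snd y) < r" for y S
    proof (rule power_series_at_continuous_compose[where n = "Suc n" and f = p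
          and \<gamma> = "\<lambda>y. ?pt (\<lambda>i. fst y * v i) (snd y)"])
      show "power_series_at (Suc n) p (?pt (\<lambda>i. fst y * v i) (snd y))"
        using extend_point_in_polydisc[OF \<rho>(2)[OF that(1)] that(2)] sub(1) by (auto intro!: r1)
      show "continuous (at y within S) (\<lambda>y. ?pt (\<lambda>i. fst y * v i) (snd y) i)" for i
        unfolding extend_point_def by (cases "i < n"; cases "i = n") (auto intro!: continuous_intros)
    qed simp
    have "continuous_on ?K (\<lambda>y. cmod (p (?pt (\<lambda>i. fst y * v i) (snd y))))"
    proof (intro continuous_on_norm)
      show "continuous_on ?K (\<lambda>y. p (?pt (\<lambda>i. fst y * v i) (snd y)))"
        unfolding continuous_on_eq_continuous_within
        using \<rho>(1) \<open>0 < r\<close> by (intro ballI contp) auto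
    qed
    moreover have "compact ?K" by (intro compact_Times) auto
    moreover have "(0, of_real (r/2)) \<in> ?K" using \<rho>(1) \<open>0 < r\<close> by simp
    then have "?K \<noteq> {}" by blast
    ultimately obtain y0 where y0: "y0 \<in> ?K"
      "\<And>y. y \<in> ?K \<Longrightarrow> cmod (p (?pt (\<lambda>i. fst y0 * v i) (snd y0))) \<le> cmod (p (?pt (\<lambda>i. fst y * v i) (snd y)))"
      using continuous_attains_inf[of ?K "\<lambda>y. cmod (p (?pt (\<lambda>i. fst y * v i) (snd y)))"] by blast
    define c where "c = cmod (p (?pt (\<lambda>i. fst y0 * v i) (snd y0)))"
    have "0 < c"
    proof -
      have "snd y0 \<noteq> 0" "cmod (snd y0) < r" "cmod (fst y0) < \<rho>" using y0(1) \<open>0 < r\<close> \<rho>(1) by auto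
      then show ?thesis unfolding c_def using nz[OF \<rho>(2)] by simp
    qed
    \<comment> \<open>For these \<open>s\<close> the function \<open>1/p\<close> is holomorphic in
      \<open>w\<close> on the whole disc, so the bound passes from the circle to the centre
      \<open>w = 0\<close>.\<close>
    have bound: "c \<le> cmod (p (?pt (\<lambda>i. s * v i) 0))" if s: "cmod s \<le> \<rho>/2" "A (\<lambda>i. s * v i) \<noteq> 0" for s
    proof -
      have x: "(\<lambda>i. s * v i) \<in> polydisc n r" using s(1) \<rho> by auto
      let ?u = "\<lambda>w. inverse (p (?pt (\<lambda>i. s * v i) w))"
      have "?u holomorphic_on ball 0 r"
      proof (rule holomorphic_on_inverse)
        show "(\<lambda>w. p (?pt (\<lambda>i. s * v i) w)) holomorphic_on ball 0 r"
          unfolding holomorphic_on_open[OF open_ball]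
          using pd[OF x] by (auto simp: field_differentiable_def)
        show "p (?pt (\<lambda>i. s * v i) w) \<noteq> 0" if "w \<in> ball 0 r" for w
          using nz[OF x] that s(2) by auto
      qed
      then have hol: "?u holomorphic_on cball 0 (r/2)"
        by (rule holomorphic_on_subset) (use \<open>0 < r\<close> in auto)
      have "cmod (?u 0) \<le> inverse c"
      proof (rule maximum_modulus_frontier[of ?u "cball 0 (r/2)"])
        show "?u holomorphic_on interior (cball 0 (r/2))"
          using hol by (rule holomorphic_on_subset) (auto simp: interior_subset)
        show "continuous_on (closure (cball 0 (r/2))) ?u"
          using holomorphic_on_imp_continuous_on[OF hol] by simp
        fix w :: complex assume "w \<in> frontier (cball 0 (r/2))"
        then have "(s, w) \<in> ?K" using s(1) \<open>0 < r\<close> by simp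
        from y0(2)[OF this] have "c \<le> cmod (p (?pt (\<lambda>i. s * v i) w))" by (simp add: c_def)
        with \<open>0 < c\<close> show "cmod (?u w) \<le> inverse c"
          by (simp add: norm_inverse le_imp_inverse_le)
      qed (use \<open>0 < r\<close> in auto)
      moreover have "p (?pt (\<lambda>i. s * v i) 0) \<noteq> 0" using nz[OF x] s(2) \<open>0 < r\<close> by simp
      ultimately show ?thesis
        using \<open>0 < c\<close> by (simp add: norm_inverse)
    qed
    have "continuous (at 0) (\<lambda>s. p (?pt (\<lambda>i. s * v i) 0))"
    proof (rule power_series_at_continuous_compose[where n = "Suc n" and f = p and \<gamma> = "\<lambda>s. ?pt (\<lambda>i. s * v i) 0"])
      show "power_series_at (Suc n) p (?pt (\<lambda>i. 0 * v i) 0)"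
        using extend_point_in_polydisc[OF \<rho>(2)[of 0], of 0] \<rho>(1) \<open>0 < r\<close> sub(1) by (auto intro!: r1)
      show "continuous (at 0) (\<lambda>s. ?pt (\<lambda>i. s * v i) 0 i)" for i
        unfolding extend_point_def by (cases "i < n"; cases "i = n") (auto intro!: continuous_intros)
    qed simp
    then have "((\<lambda>s. cmod (p (?pt (\<lambda>i. s * v i) 0))) \<longlongrightarrow> cmod (p (?pt (\<lambda>i. 0 * v i) 0))) (at 0)"
      unfolding continuous_within by (rule tendsto_norm)
    moreover have "eventually (\<lambda>s. c \<le> cmod (p (?pt (\<lambda>i. s * v i) 0))) (at 0)"
    proof -
      have "eventually (\<lambda>s. cmod s < \<rho>/2) (at 0)"
        using \<rho>(1) eventually_at[of "\<lambda>s. cmod s < \<rho>/2" 0 UNIV] by (auto intro!: exI[of _ "\<rho>/2"])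
      with ev show ?thesis
        by eventually_elim (auto intro: bound)
    qed
    \<comment> \<open>The bound survives the limit \<open>s = 0\<close>. Only in this way is the
      origin reached: there \<open>A\<close> and \<open>w\<close> both vanish, and the argument
      about simple zeros says nothing.\<close>
    ultimately have "c \<le> cmod (p (?pt (\<lambda>i. 0 * v i) 0))"
      by (rule tendsto_lowerbound) auto
    moreover have "?pt (\<lambda>i. 0 * v i) 0 = origin" by (auto simp: extend_point_def)
    ultimately have "p origin \<noteq> 0" using \<open>0 < c\<close> by auto
    then show False using holomorphic_germ_nonzero_unit[OF holp] nunit by simp
  qed
  ultimately have "reduced_germ (Suc n) F"
    unfolding reduced_germ_def by blast
  then show ?thesis by (simp add: F_def)
qed

section \<open>Homology of punctured initial cones\<close>

lemma topspace_nsphere: "topspace (nsphere p) = {x. (\<Sum>i\<le>p. (x i)\<^sup>2) = 1 \<and> (\<forall>i>p. x i = 0)}"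
  by (simp add: nsphere)

abbreviation punctured_Euclidean_space :: "nat \<Rightarrow> (nat \<Rightarrow> real) topology"
  where "punctured_Euclidean_space n \<equiv> subtopology (Euclidean_space n) (- {\<lambda>_. 0})"

lemma continuous_map_Euclidean_space_coordinate:
  "continuous_map (Euclidean_space n) euclideanreal (\<lambda>x. x i)"
  unfolding Euclidean_space_def
  by (intro continuous_map_from_subtopology continuous_map_product_projection) auto

lemma continuous_map_into_Euclidean_space:
  "continuous_map X (Euclidean_space n) f \<longleftrightarrow>
    (\<forall>i. continuous_map X euclideanreal (\<lambda>x. f x i)) \<and> (\<forall>x\<in>topspace X. \<forall>i\<ge>n. f x i = 0)"
  unfolding Euclidean_space_def
  by (auto simp: continuous_map_in_subtopology continuous_map_componentwise_UNIV)

lemma nsphere_eq_subtopology_Euclidean_space: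
  "nsphere p = subtopology (Euclidean_space (Suc p)) {x. (\<Sum>i\<le>p. (x i)\<^sup>2) = 1}"
  unfolding nsphere Euclidean_space_def subtopology_subtopology
  by (rule arg_cong[where f = "subtopology _"]) (auto simp: Suc_le_eq)

lemma homotopy_equivalent_punctured_Euclidean_space_nsphere:
  "punctured_Euclidean_space (Suc p) homotopy_equivalent_space nsphere p"
proof -
  let ?E = "punctured_Euclidean_space (Suc p)"
  define N where "N = (\<lambda>x :: nat \<Rightarrow> real. sqrt (\<Sum>i\<le>p. (x i)\<^sup>2))"
  define r where "r = (\<lambda>(x :: nat \<Rightarrow> real) i. x i / N x)"
  have pos: "0 < N x" if "x \<in> topspace ?E" for x
  proof -
    from that have z: "\<forall>i\<ge>Suc p. x i = 0" "x \<noteq> (\<lambda>_. 0)"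
      by (auto simp: topspace_Euclidean_space)
    then obtain i where "i \<le> p" "x i \<noteq> 0" by (metis ext not_less_eq_eq)
    then have "0 < (\<Sum>i\<le>p. (x i)\<^sup>2)" by (intro sum_pos2[where i = i]) auto
    then show ?thesis by (simp add: N_def)
  qed
  have cc: "continuous_map ?E euclideanreal (\<lambda>x. x i)" for i
    by (intro continuous_map_from_subtopology continuous_map_Euclidean_space_coordinate)
  have cN: "continuous_map ?E euclideanreal N"
  proof -
    have "continuous_map ?E euclideanreal (\<lambda>x. \<Sum>i\<le>p. (x i)\<^sup>2)"
      by (intro continuous_map_sum continuous_map_real_pow cc) auto
    from continuous_map_compose[OF this, of euclideanreal sqrt] show ?thesis
      by (simp add: N_def o_def continuous_on_real_sqrt)
  qed
  have N1: "(\<Sum>i\<le>p. (x i)\<^sup>2) = 1 \<Longrightarrow> N x = 1" for x by (simp add: N_def)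
  have sphere_r: "(\<Sum>i\<le>p. (r x i)\<^sup>2) = 1" if "x \<in> topspace ?E" for x
  proof -
    have "(\<Sum>i\<le>p. (r x i)\<^sup>2) = (\<Sum>i\<le>p. (x i)\<^sup>2) / (N x)\<^sup>2"
      by (simp add: r_def power_divide sum_divide_distrib)
    also have "(N x)\<^sup>2 = (\<Sum>i\<le>p. (x i)\<^sup>2)"
      by (simp add: N_def sum_nonneg)
    finally show ?thesis using pos[OF that] by (simp add: N_def)
  qed
  have cr: "continuous_map ?E (nsphere p) r"
    unfolding nsphere_eq_subtopology_Euclidean_space continuous_map_in_subtopology
    by (auto simp: continuous_map_into_Euclidean_space r_def topspace_Euclidean_space sphere_r[unfolded r_def]
        intro!: continuous_map_real_divide cc cN less_imp_neq[OF pos, THEN not_sym])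
  have ci: "continuous_map (nsphere p) ?E id"
    unfolding nsphere_eq_subtopology_Euclidean_space
    by (auto simp: continuous_map_in_subtopology continuous_map_from_subtopology)
  have "homotopic_with (\<lambda>_. True) ?E ?E (id \<circ> r) id"
  proof -
    \<comment> \<open>The divisor is interpolated from \<open>N x\<close> at \<open>t = 0\<close> to
      1 at \<open>t = 1\<close>. Points move along rays and never reach 0.\<close>
    define h where "h = (\<lambda>(t, x :: nat \<Rightarrow> real) i. x i / ((1 - t) * N x + t))"
    have ne: "(1 - t) * N x + t \<noteq> 0" if "t \<in> {0..1}" "x \<in> topspace ?E" for t x
    proof -
      have "0 < (1 - t) * N x + t"
        using pos[OF that(2)] that(1) by (cases "t = 0") (auto intro: add_nonneg_pos)
      then show ?thesis by simp
    qed
    let ?P = "prod_topology (top_of_set {0..1::real}) ?E"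
    have c2: "continuous_map ?P euclideanreal (\<lambda>u. snd u i)" for i
      using continuous_map_compose[OF continuous_map_snd cc] by (simp add: o_def)
    have cN2: "continuous_map ?P euclideanreal (\<lambda>u. N (snd u))"
      using continuous_map_compose[OF continuous_map_snd cN] by (simp add: o_def)
    have c1: "continuous_map ?P euclideanreal fst"
      by (metis continuous_map_fst continuous_map_in_subtopology)
    have "continuous_map ?P ?E h"
      unfolding continuous_map_in_subtopology continuous_map_into_Euclidean_space
    proof (intro conjI allI)
      show "continuous_map ?P euclideanreal (\<lambda>u. h u i)" for i
        unfolding h_def case_prod_unfold
        by (intro continuous_map_real_divide continuous_intros c1 c2 cN2) (use ne in auto)
      show "\<forall>u\<in>topspace ?P. \<forall>i\<ge>Suc p. h u i = 0"
        by (auto simp: h_def topspace_Euclidean_space)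
      show "h \<in> topspace ?P \<rightarrow> - {\<lambda>_. 0}"
      proof (rule Pi_I)
        fix u assume u: "u \<in> topspace ?P"
        obtain t x where tx: "u = (t, x)" by (cases u)
        with u have x: "t \<in> {0..1}" "x \<in> topspace ?E" by auto
        then obtain i where "x i \<noteq> 0" by (auto simp: fun_eq_iff)
        then have "h u i \<noteq> 0" using ne[OF x] by (simp add: h_def tx)
        then show "h u \<in> - {\<lambda>_. 0}" by (auto simp: fun_eq_iff)
      qed
    qed
    then show ?thesis
      unfolding homotopic_with_def by (intro exI[of _ h]) (auto simp: h_def r_def)
  qed
  moreover have "homotopic_with (\<lambda>_. True) (nsphere p) (nsphere p) (r \<circ> id) id"
  proof (rule homotopic_with_equal)
    show "continuous_map (nsphere p) (nsphere p) (r \<circ> id)"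
      by (rule continuous_map_compose[OF ci cr])
    show "(r \<circ> id) x = id x" if "x \<in> topspace (nsphere p)" for x
      using that N1 by (auto simp: topspace_nsphere r_def)
  qed auto
  ultimately show ?thesis
    unfolding homotopy_equivalent_space_def using cr ci by blast
qed

text \<open>Outside degree 0 reduced and ordinary homology agree, so the reduced homology of the
  sphere decides.\<close>

lemma trivial_homology_group_punctured_Euclidean_space:
  assumes "q \<noteq> 0"
  shows "trivial_group (homology_group q (punctured_Euclidean_space (Suc p))) \<longleftrightarrow> q \<noteq> int p"
proof -
  have "reduced_homology_group q (punctured_Euclidean_space (Suc p)) \<cong> reduced_homology_group q (nsphere p)"
    by (intro homotopy_equivalent_space_imp_isomorphic_reduced_homology_groups
        homotopy_equivalent_punctured_Euclidean_space_nsphere)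
  then have "trivial_group (reduced_homology_group q (punctured_Euclidean_space (Suc p))) \<longleftrightarrow> q \<noteq> int p"
    by (simp add: isomorphic_group_triviality trivial_reduced_homology_group_nsphere)
  then show ?thesis by (simp add: un_reduced_homology_group[OF assms])
qed

text \<open>The continuous left inverse of \<open>f\<close> makes the induced map on homology
  injective. Used contrapositively: the class of a sphere in a punctured real space survives in the
  cone.\<close>

lemma trivial_homology_group_section_map:
  assumes "section_map X Y f" "trivial_group (homology_group q Y)"
  shows "trivial_group (homology_group q X)"
proof -
  have Y: "carrier (homology_group q Y) = {\<one>\<^bsub>homology_group q Y\<^esub>}"
    using assms(2) by (simp add: trivial_group_def)
  let ?f = "hom_induced q X {} Y {} f"
  have one: "\<one>\<^bsub>homology_group q X\<^esub> \<in> carrier (homology_group q X)"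
    by (rule monoid.one_closed[OF group.is_monoid]) simp
  have "x = \<one>\<^bsub>homology_group q X\<^esub>" if "x \<in> carrier (homology_group q X)" for x
  proof (rule inj_onD[OF inj_on_hom_induced_section_map[OF assms(1)] _ that one])
    have "?f y = \<one>\<^bsub>homology_group q Y\<^esub>" for y
      using Y hom_induced_carrier[of q X "{}" Y "{}" f y] by simp
    then show "?f x = ?f \<one>\<^bsub>homology_group q X\<^esub>" by simp
  qed
  with one have "carrier (homology_group q X) = {\<one>\<^bsub>homology_group q X\<^esub>}" by blast
  then show ?thesis by (simp add: trivial_group_def)
qed

section \<open>Identifying C^n with R^(2n)\<close>

definition real_coordinates :: "(nat \<Rightarrow> complex) \<Rightarrow> nat \<Rightarrow> real"
  where "real_coordinates z i = (if even i then Re (z (i div 2)) else Im (z (i div 2)))"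

definition complex_coordinates :: "(nat \<Rightarrow> real) \<Rightarrow> nat \<Rightarrow> complex"
  where "complex_coordinates x i = Complex (x (2 * i)) (x (Suc (2 * i)))"

lemma complex_real_coordinates [simp]: "complex_coordinates (real_coordinates z) = z"
  by (auto simp: complex_coordinates_def real_coordinates_def)

lemma real_complex_coordinates [simp]: "real_coordinates (complex_coordinates x) = x"
proof
  fix i show "real_coordinates (complex_coordinates x) i = x i"
    by (cases "even i") (auto simp: complex_coordinates_def real_coordinates_def elim!: evenE oddE)
qed

lemma real_coordinates_origin [simp]: "real_coordinates origin = (\<lambda>_. 0)"
  by (auto simp: real_coordinates_def)

lemma complex_coordinates_zero [simp]: "complex_coordinates (\<lambda>_. 0) = origin"
  by (auto simp: complex_coordinates_def complex_eq_iff)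

lemma continuous_map_real_coordinates:
  assumes "\<And>i. continuous_map X euclidean (\<lambda>x. f x i)"
  shows "continuous_map X euclideanreal (\<lambda>x. real_coordinates (f x) i)"
  unfolding real_coordinates_def
  using continuous_map_compose[OF assms, of euclideanreal Re "i div 2"] continuous_map_compose[OF assms, of euclideanreal Im "i div 2"]
  by (auto simp: o_def continuous_on_Re continuous_on_Im)

lemma continuous_map_complex_coordinates:
  assumes "\<And>i. continuous_map X euclideanreal (\<lambda>x. f x i)"
  shows "continuous_map X euclidean (\<lambda>x. complex_coordinates (f x) i)"
proof -
  have "continuous_map X euclidean (\<lambda>x. complex_of_real (f x (2 * i)))"
    using continuous_map_compose[OF assms, of euclidean complex_of_real] by (simp add: o_def)
  moreover have "continuous_map euclideanreal euclidean (\<lambda>t. \<i> * complex_of_real t)"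
    by (auto intro!: continuous_intros)
  from continuous_map_compose[OF assms this]
  have "continuous_map X euclidean (\<lambda>x. \<i> * complex_of_real (f x (Suc (2 * i))))"
    by (simp add: o_def)
  ultimately show ?thesis
    unfolding complex_coordinates_def Complex_eq by (rule continuous_map_add)
qed

lemma homeomorphic_space_punctured_complex_space:
  "subtopology (complex_space n) (- {origin}) homeomorphic_space punctured_Euclidean_space (2 * n)"
  unfolding homeomorphic_space_def
proof (intro exI)
  let ?X = "subtopology (complex_space n) (- {origin})" and ?Y = "punctured_Euclidean_space (2 * n)"
  have X: "continuous_map ?X euclidean (\<lambda>z. z i)" for i
    by (intro continuous_map_from_subtopology continuous_map_complex_space_coordinate)
  have Y: "continuous_map ?Y euclideanreal (\<lambda>x. x i)" for i
    by (intro continuous_map_from_subtopology continuous_map_Euclidean_space_coordinate)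
  have inj: "x = (\<lambda>_. 0)" if "complex_coordinates x = origin" for x
    using arg_cong[OF that, of real_coordinates] by simp
  have inj': "z = origin" if "real_coordinates z = (\<lambda>_. 0)" for z
    using arg_cong[OF that, of complex_coordinates] by simp
  show "homeomorphic_maps ?X ?Y real_coordinates complex_coordinates"
    unfolding homeomorphic_maps_def
  proof (intro conjI)
    show "continuous_map ?X ?Y real_coordinates"
      unfolding continuous_map_in_subtopology continuous_map_into_Euclidean_space
      using continuous_map_real_coordinates[of ?X "\<lambda>z. z"] X
      by (auto simp: real_coordinates_def topspace_complex_space dest: inj')
    show "continuous_map ?Y ?X complex_coordinates"
      unfolding continuous_map_in_subtopology continuous_map_into_complex_space
      using continuous_map_complex_coordinates[of ?Y "\<lambda>x. x"] Y
      by (auto simp: complex_coordinates_def topspace_Euclidean_space complex_eq_iff dest: inj)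
  qed auto
qed

section \<open>The punctured cones of F and G\<close>

lemma continuous_map_complex_space_subtopology_iff:
  "continuous_map (subtopology (complex_space n) S) euclidean f \<longleftrightarrow>
    continuous_on ({z. \<forall>i\<ge>n. z i = 0} \<inter> S) f"
  by (simp add: complex_space_eq_top_of_set subtopology_subtopology)

lemma continuous_map_punctured_Euclidean_space_iff:
  "continuous_map (punctured_Euclidean_space n) euclidean f \<longleftrightarrow>
    continuous_on ({x. \<forall>i\<ge>n. x i = 0} \<inter> - {\<lambda>_. 0}) f"
  by (simp add: Euclidean_space_def euclidean_product_topology subtopology_subtopology)

text \<open>The retraction avoids 0 for the following reason. If all its components vanish, then
  with \<open>s = |y1| = |y2|\<close> one has \<open>w = 0\<close> and \<open>x = s^2 v\<close>, so
  the equation of the cone reads \<open>(s^(2m) P v)^2 y1 y2 = 0\<close>. As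
  \<open>P v \<noteq> 0\<close>, this forces \<open>s = 0\<close>, and the point is the
  origin.\<close>

lemma section_map_punctured_Euclidean_space_cone:
  assumes P: "homogeneous_polynomial n m P"
    and v: "v \<in> topspace (complex_space n)" "P v \<noteq> 0"
    and q: "\<And>z. z \<in> topspace (complex_space (n + 3)) \<Longrightarrow> q z = (P (trunc_at n z))\<^sup>2 * z n * z (n + 1)"
  shows "\<exists>\<sigma>. section_map (punctured_Euclidean_space (2 * n + 3))
      (subtopology (complex_space (n + 3)) ({z. q z = 0} - {origin})) \<sigma>"
proof -
  let ?E = "punctured_Euclidean_space (2 * n + 3)"
  let ?X = "subtopology (complex_space (n + 3)) ({z. q z = 0} - {origin})"
  \<comment> \<open>Slots \<open>n\<close>, \<open>n + 1\<close>, \<open>n + 2\<close> of a point of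
    the cone hold \<open>y1\<close>, \<open>y2\<close>, \<open>w\<close>. Under
    \<open>complex_coordinates\<close> a sequence vanishing from \<open>2 * n + 3\<close> on is
    \<open>(x, w, t)\<close>, with \<open>w\<close> in slot \<open>n\<close> and the real number
    \<open>t\<close> in slot \<open>n + 1\<close>.\<close>
  define \<sigma> where "\<sigma> x i = (if i < n then complex_coordinates x i
      else if i = n then of_real (max (x (2 * n + 2)) 0)
      else if i = n + 1 then of_real (max (- x (2 * n + 2)) 0)
      else if i = n + 2 then complex_coordinates x n else 0)" for x i
  \<comment> \<open>The target has the order \<open>(x, w, t)\<close>, so \<open>w\<close> moves
    from slot \<open>n + 2\<close> to slot \<open>n\<close>.\<close>
  define c where "c z i = (if i < n then z i - of_real (cmod (z n * z (n + 1))) * v i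
      else if i = n then z (n + 2)
      else if i = n + 1 then of_real (cmod (z n) - cmod (z (n + 1))) else 0)" for z i
  have \<sigma>n: "\<sigma> x n = of_real (max (x (2 * n + 2)) 0)"
    and \<sigma>n1: "\<sigma> x (Suc n) = of_real (max (- x (2 * n + 2)) 0)"
    and \<sigma>n2: "\<sigma> x (n + 2) = complex_coordinates x n" for x
    by (simp_all add: \<sigma>_def)
  have c\<sigma>: "c (\<sigma> x) = complex_coordinates x" if "x \<in> topspace ?E" for x
  proof
    fix i
    have x0: "x j = 0" if "2 * n + 3 \<le> j" for j
      using that \<open>x \<in> topspace ?E\<close> by (auto simp: topspace_Euclidean_space)
    \<comment> \<open>The positive or the negative part of \<open>t\<close> is 0, so the correction
      by \<open>v\<close> disappears on the image of the section.\<close>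
    have prod: "\<sigma> x n * \<sigma> x (n + 1) = 0" by (auto simp: \<sigma>n \<sigma>n1 max_def)
    consider "i < n" | "i = n" | "i = n + 1" | "n + 2 \<le> i" by linarith
    then show "c (\<sigma> x) i = complex_coordinates x i"
    proof cases
      case 1
      then show ?thesis using prod by (simp add: c_def) (simp add: \<sigma>_def)
    next
      case 2
      then show ?thesis using \<sigma>n2 by (simp add: c_def)
    next
      case 3
      have "cmod (\<sigma> x n) - cmod (\<sigma> x (n + 1)) = x (2 * n + 2)"
        by (simp add: \<sigma>n \<sigma>n1 max_def)
      then have "c (\<sigma> x) (n + 1) = of_real (x (2 * n + 2))" by (simp add: c_def flip: of_real_diff)
      \<comment> \<open>Entry \<open>2 * n + 3\<close> is the imaginary part of slot
        \<open>n + 1\<close>.\<close>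
      moreover have "complex_coordinates x (n + 1) = of_real (x (2 * n + 2))"
        using x0[of "2 * n + 3"] by (simp add: complex_coordinates_def complex_eq_iff eval_nat_numeral)
      ultimately show ?thesis using 3 by simp
    next
      case 4
      then show ?thesis
        using x0[of "2 * i"] x0[of "Suc (2 * i)"] by (simp add: c_def complex_coordinates_def complex_eq_iff)
    qed
  qed
  have "continuous_map ?E ?X \<sigma>"
    unfolding continuous_map_in_subtopology continuous_map_into_complex_space
  proof (intro conjI allI)
    show "continuous_map ?E euclidean (\<lambda>x. \<sigma> x i)" for i
    proof -
      have cc: "continuous_map ?E euclidean (\<lambda>x. complex_coordinates x j)" for j
        by (intro continuous_map_complex_coordinates continuous_map_from_subtopology continuous_map_Euclidean_space_coordinate)
      have co: "continuous_map ?E euclidean (\<lambda>x. complex_of_real (max (x j) 0))"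
        "continuous_map ?E euclidean (\<lambda>x. complex_of_real (max (- x j) 0))" for j
        unfolding continuous_map_punctured_Euclidean_space_iff
        by (intro continuous_on_of_real continuous_on_max continuous_on_minus continuous_on_const
            continuous_on_subset[OF continuous_on_product_coordinates subset_UNIV])+
      show ?thesis
        unfolding \<sigma>_def using cc co by (cases "i < n"; cases "i = n"; cases "i = n + 1"; cases "i = n + 2") auto
    qed
    show "\<forall>x\<in>topspace ?E. \<forall>i\<ge>n + 3. \<sigma> x i = 0" by (simp add: \<sigma>_def)
    show "\<sigma> \<in> topspace ?E \<rightarrow> {z. q z = 0} - {origin}"
    proof (rule Pi_I)
      fix x assume x: "x \<in> topspace ?E"
      have "\<sigma> x \<in> topspace (complex_space (n + 3))" by (simp add: \<sigma>_def topspace_complex_space)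
      moreover have "\<sigma> x n * \<sigma> x (n + 1) = 0" by (auto simp: \<sigma>n \<sigma>n1 max_def)
      ultimately have "q (\<sigma> x) = 0" using q by simp
      moreover have "\<sigma> x \<noteq> origin"
      proof
        assume "\<sigma> x = origin"
        then have "complex_coordinates x = c origin" using c\<sigma>[OF x] by simp
        also have "c origin = origin" by (auto simp: c_def)
        finally have "real_coordinates (complex_coordinates x) = real_coordinates origin" by (rule arg_cong)
        with x show False by simp
      qed
      ultimately show "\<sigma> x \<in> {z. q z = 0} - {origin}" by simp
    qed
  qed
  moreover have "continuous_map ?X ?E (\<lambda>z. real_coordinates (c z))"
    unfolding continuous_map_in_subtopology[of _ "Euclidean_space (2 * n + 3)"] continuous_map_into_Euclidean_space
  proof (intro conjI allI)
    have "continuous_map ?X euclidean (\<lambda>z. c z i)" for i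
      unfolding continuous_map_complex_space_subtopology_iff c_def
      by (cases "i < n"; cases "i = n"; cases "i = n + 1")
         (auto intro!: continuous_intros continuous_on_subset[OF continuous_on_product_coordinates subset_UNIV])
    then show "continuous_map ?X euclideanreal (\<lambda>z. real_coordinates (c z) i)" for i
      by (rule continuous_map_real_coordinates)
    show "\<forall>z\<in>topspace ?X. \<forall>i\<ge>2 * n + 3. real_coordinates (c z) i = 0"
    proof (intro ballI allI impI)
      fix z i assume "2 * n + 3 \<le> i"
      then consider "i = 2 * n + 3" | "n + 2 \<le> i div 2" by linarith
      then show "real_coordinates (c z) i = 0"
      proof cases
        \<comment> \<open>This index is the imaginary part of slot \<open>n + 1\<close>, where
          \<open>c\<close> takes real values.\<close>
        case 1
        then have "odd i" "i div 2 = n + 1" by simp_all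
        then show ?thesis by (simp add: real_coordinates_def c_def)
      next
        case 2
        then have "c z (i div 2) = 0" by (simp add: c_def)
        then show ?thesis by (simp add: real_coordinates_def)
      qed
    qed
    show "(\<lambda>z. real_coordinates (c z)) \<in> topspace ?X \<rightarrow> - {\<lambda>_. 0}"
    proof (rule Pi_I)
      fix z assume "z \<in> topspace ?X"
      then have z: "z \<in> topspace (complex_space (n + 3))" "q z = 0" "z \<noteq> origin" by auto
      have False if "real_coordinates (c z) = (\<lambda>_. 0)"
      proof -
        have c0: "c z = origin" using arg_cong[OF that, of complex_coordinates] by simp
        define s where "s = cmod (z n)"
        have s: "cmod (z (n + 1)) = s"
          using fun_cong[OF c0, of "n + 1"] by (simp add: c_def s_def of_real_diff[symmetric] del: of_real_diff)
        have w: "z (n + 2) = 0" using fun_cong[OF c0, of n] by (simp add: c_def)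
        have x: "z i = of_real (s\<^sup>2) * v i" if "i < n" for i
          using fun_cong[OF c0, of i] that s by (simp add: c_def s_def norm_mult power2_eq_square)
        have "trunc_at n z = (\<lambda>i. of_real (s\<^sup>2) * v i)"
          using x v(1) by (auto simp: trunc_at_def topspace_complex_space)
        then have "q z = (of_real (s\<^sup>2) ^ m * P v)\<^sup>2 * z n * z (n + 1)"
          using q[OF z(1)] by (simp add: homogeneous_polynomial_scale[OF P])
        with z(2) v(2) have "s = 0 \<or> z n = 0 \<or> z (n + 1) = 0" by auto
        then have "s = 0" using s by (auto simp: s_def)
        have "z i = 0" for i
        proof -
          consider "i < n" | "i = n" | "i = n + 1" | "i = n + 2" | "n + 3 \<le> i" by linarith
          then show ?thesis
          proof cases
            case 1
            then show ?thesis using x \<open>s = 0\<close> by simp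
          next
            case 2
            then show ?thesis using \<open>s = 0\<close> by (simp add: s_def)
          next
            case 3
            then show ?thesis using \<open>s = 0\<close> s by simp
          next
            case 4
            then show ?thesis using w by simp
          next
            case 5
            then show ?thesis using z(1) by (simp add: topspace_complex_space)
          qed
        qed
        with z(3) show False by auto
      qed
      then show "real_coordinates (c z) \<in> - {\<lambda>_. 0}" by blast
    qed
  qed
  moreover have "real_coordinates (c (\<sigma> x)) = x" if "x \<in> topspace ?E" for x
    using c\<sigma>[OF that] by simp
  ultimately have "section_map ?E ?X \<sigma>"
    unfolding section_map_def retraction_maps_def by blast
  then show ?thesis by blast
qed

text \<open>C^n is literally the subset of C^(n+1) where entry \<open>n\<close> is 0, so the two
  spaces are equal and not merely homeomorphic.\<close>

lemma hyperplane_cone_eq: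
  assumes "\<And>z. z \<in> topspace (complex_space (Suc n)) \<Longrightarrow> q z = z n ^ d" "0 < d"
  shows "subtopology (complex_space (Suc n)) ({z. q z = 0} - {origin}) =
    subtopology (complex_space n) (- {origin})"
proof -
  have "{z. \<forall>i\<ge>Suc n. z i = 0} \<inter> ({z. q z = 0} - {origin}) = {z. \<forall>i\<ge>n. z i = 0} \<inter> - {origin}"
  proof (rule Set.set_eqI)
    fix z
    show "z \<in> {z. \<forall>i\<ge>Suc n. z i = 0} \<inter> ({z. q z = 0} - {origin}) \<longleftrightarrow> z \<in> {z. \<forall>i\<ge>n. z i = 0} \<inter> - {origin}"
    proof (cases "\<forall>i\<ge>Suc n. z i = 0")
      case True
      then have "q z = 0 \<longleftrightarrow> z n = 0" using assms by (simp add: topspace_complex_space)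
      moreover have "(\<forall>i\<ge>n. z i = 0) \<longleftrightarrow> z n = 0"
        using True by (metis le_antisym not_less_eq_eq order_refl)
      ultimately show ?thesis using True by simp
    next
      case False
      then show ?thesis by auto
    qed
  qed
  then show ?thesis
    by (simp add: complex_space_def subtopology_subtopology)
qed

section \<open>Products of a homeomorphism germ with the identity\<close>

text \<open>Entries from \<open>n\<close> on are copied, so one formula gives the product of
  \<open>\<phi>\<close> with the identity on every C^N with \<open>N \<ge> n\<close>.\<close>

definition extend_map :: "nat \<Rightarrow> ((nat \<Rightarrow> complex) \<Rightarrow> nat \<Rightarrow> complex) \<Rightarrow> (nat \<Rightarrow> complex) \<Rightarrow> nat \<Rightarrow> complex"
  where "extend_map n \<phi> z = (\<lambda>i. if i < n then \<phi> (trunc_at n z) i else z i)"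

lemma trunc_at_extend_map: "trunc_at n (extend_map n \<phi> z) = trunc_at n (\<phi> (trunc_at n z))"
  by (auto simp: trunc_at_def extend_map_def)

lemma continuous_map_trunc_at:
  "continuous_map (complex_space N) (complex_space n) (trunc_at n)"
  unfolding continuous_map_into_complex_space trunc_at_def
  by (auto intro: continuous_map_complex_space_coordinate)

lemma homeomorphism_germ_extend_map:
  assumes "homeomorphism_germ n \<phi>" "n \<le> N"
  shows "homeomorphism_germ N (extend_map n \<phi>)"
proof -
  obtain U V where UV: "openin (complex_space n) U" "openin (complex_space n) V" "origin \<in> U" "origin \<in> V"
    and "homeomorphic_map (subtopology (complex_space n) U) (subtopology (complex_space n) V) \<phi>"
    and "\<phi> origin = origin"
    using assms(1) unfolding homeomorphism_germ_def by blast
  then obtain \<psi> where \<psi>: "homeomorphic_maps (subtopology (complex_space n) U) (subtopology (complex_space n) V) \<phi> \<psi>"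
    by (auto simp: homeomorphic_map_maps)
  \<comment> \<open>The cylinder \<open>W \<times> C^(N - n)\<close>.\<close>
  define lift where "lift W = {z \<in> topspace (complex_space N). trunc_at n z \<in> W}" for W
  have open_lift: "openin (complex_space N) (lift W)" if "openin (complex_space n) W" for W
    unfolding lift_def by (rule openin_continuous_map_preimage[OF continuous_map_trunc_at that])
  \<comment> \<open>\<open>\<theta>\<close> is kept general, to serve both for \<open>\<phi>\<close>
    and for its inverse \<open>\<psi>\<close>.\<close>
  have cont: "continuous_map (subtopology (complex_space N) (lift W)) (subtopology (complex_space N) (lift W')) (extend_map n \<theta>)"
    if \<theta>: "continuous_map (subtopology (complex_space n) W) (subtopology (complex_space n) W') \<theta>" for W W' \<theta>
    unfolding continuous_map_in_subtopology[of _ "complex_space N"] continuous_map_into_complex_space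
  proof (intro conjI allI)
    let ?S = "subtopology (complex_space N) (lift W)"
    have tr: "continuous_map ?S (subtopology (complex_space n) W) (trunc_at n)"
      by (auto simp: continuous_map_in_subtopology lift_def
          intro: continuous_map_from_subtopology[OF continuous_map_trunc_at])
    have \<theta>': "continuous_map (subtopology (complex_space n) W) (complex_space n) \<theta>"
      using \<theta> by (simp add: continuous_map_in_subtopology)
    have "continuous_map ?S euclidean (\<lambda>z. \<theta> (trunc_at n z) i)" for i
      using continuous_map_compose[OF continuous_map_compose[OF tr \<theta>'] continuous_map_complex_space_coordinate]
      by (simp add: o_def)
    moreover have "continuous_map ?S euclidean (\<lambda>z. z i)" for i
      by (intro continuous_map_from_subtopology continuous_map_complex_space_coordinate)
    ultimately show "continuous_map ?S euclidean (\<lambda>z. extend_map n \<theta> z i)" for i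
      by (cases "i < n") (auto simp: extend_map_def)
    show "\<forall>z\<in>topspace ?S. \<forall>i\<ge>N. extend_map n \<theta> z i = 0"
      using \<open>n \<le> N\<close> by (auto simp: extend_map_def topspace_complex_space)
    show "extend_map n \<theta> \<in> topspace ?S \<rightarrow> lift W'"
    proof (rule Pi_I)
      fix z assume z: "z \<in> topspace ?S"
      then have "trunc_at n z \<in> topspace (subtopology (complex_space n) W)" by (simp add: lift_def)
      from funcset_mem[OF continuous_map_funspace[OF \<theta>] this] have "trunc_at n (extend_map n \<theta> z) \<in> W'"
        by (simp add: trunc_at_extend_map trunc_at_id)
      moreover have "extend_map n \<theta> z \<in> topspace (complex_space N)"
        using z \<open>n \<le> N\<close> by (auto simp: extend_map_def topspace_complex_space)
      ultimately show "extend_map n \<theta> z \<in> lift W'" by (simp add: lift_def)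
    qed
  qed
  have inverse: "extend_map n \<theta>' (extend_map n \<theta> z) = z"
    if \<theta>: "homeomorphic_maps (subtopology (complex_space n) W) (subtopology (complex_space n) W') \<theta> \<theta>'"
      and z: "z \<in> topspace (subtopology (complex_space N) (lift W))" for W W' \<theta> \<theta>' z
  proof -
    have t: "trunc_at n z \<in> topspace (subtopology (complex_space n) W)" using z by (simp add: lift_def)
    have \<theta>c: "continuous_map (subtopology (complex_space n) W) (subtopology (complex_space n) W') \<theta>"
      and \<theta>i: "\<forall>x\<in>topspace (subtopology (complex_space n) W). \<theta>' (\<theta> x) = x"
      using \<theta> unfolding homeomorphic_maps_def by blast+
    have "\<theta> (trunc_at n z) \<in> topspace (complex_space n)"
      using funcset_mem[OF continuous_map_funspace[OF \<theta>c] t] by simp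
    moreover have "\<theta>' (\<theta> (trunc_at n z)) = trunc_at n z" using \<theta>i t by (rule bspec)
    ultimately have "\<theta>' (trunc_at n (extend_map n \<theta> z)) = trunc_at n z"
      by (simp add: trunc_at_extend_map trunc_at_id)
    then show ?thesis by (auto simp: extend_map_def[of n \<theta>'] trunc_at_def[of n z]) (auto simp: extend_map_def)
  qed
  have "homeomorphic_maps (subtopology (complex_space N) (lift U)) (subtopology (complex_space N) (lift V))
      (extend_map n \<phi>) (extend_map n \<psi>)"
    unfolding homeomorphic_maps_def
    using \<psi> inverse[OF \<psi>] inverse[OF \<psi>[THEN homeomorphic_maps_sym[THEN iffD1]]]
    by (auto simp: homeomorphic_maps_def intro!: cont)
  moreover have "extend_map n \<phi> origin = origin"
    using \<open>\<phi> origin = origin\<close> by (auto simp: extend_map_def)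
  moreover have "origin \<in> lift U" "origin \<in> lift V"
    using UV by (simp_all add: lift_def)
  ultimately show ?thesis
    unfolding homeomorphism_germ_def homeomorphic_map_maps
    by (intro conjI exI[of _ "lift U"] exI[of _ "lift V"] exI[of _ "extend_map n \<psi>"] open_lift UV(1,2))
qed

section \<open>The comparison germs\<close>

text \<open>The variables \<open>y1\<close>, \<open>y2\<close>, \<open>w\<close> occupy slots
  \<open>n\<close>, \<open>n + 1\<close>, \<open>n + 2\<close>. F and G arise from \<open>f\<close>
  and \<open>g\<close> with a common \<open>d\<close>.\<close>

definition suspended_germ :: "nat \<Rightarrow> nat \<Rightarrow> ((nat \<Rightarrow> complex) \<Rightarrow> complex) \<Rightarrow> (nat \<Rightarrow> complex) \<Rightarrow> complex"
  where "suspended_germ n d f z = (f (trunc_at n z))\<^sup>2 * z n * z (n + 1) + z (n + 2) ^ d"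

lemma reduced_suspended_germ:
  assumes "reduced_germ n f" "2 \<le> d"
  shows "reduced_germ (n + 3) (suspended_germ n d f)"
proof -
  define A where "A z = (f (trunc_at n z))\<^sup>2 * z n * z (n + 1)" for z
  have f: "holomorphic_germ n f" "\<not> germ_eq n f (\<lambda>_. 0)"
    using assms(1) by (auto simp: reduced_germ_def)
  have "holomorphic_germ (n + 2) A"
    unfolding A_def
    by (intro holomorphic_germ_mult holomorphic_germ_power holomorphic_germ_trunc_at holomorphic_germ_coordinate f(1)) auto
  moreover have "A origin = 0" by (simp add: A_def)
  moreover have "\<not> germ_eq (n + 2) A (\<lambda>_. 0)"
  proof
    assume "germ_eq (n + 2) A (\<lambda>_. 0)"
    then obtain r where r: "0 < r" "\<And>z. z \<in> polydisc (n + 2) r \<Longrightarrow> A z = 0"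
      by (auto simp: germ_eq_iff)
    obtain v where v: "v \<in> topspace (complex_space n)" "initial_form n f v \<noteq> 0"
      using initial_form_properties(3)[OF f] by blast
    \<comment> \<open>In the direction \<open>(v, 1, 1)\<close> the germ \<open>A\<close> restricts
      to \<open>f(t v)^2 t^2\<close>, which is nonzero for small
      \<open>t \<noteq> 0\<close>.\<close>
    define u where "u i = (if i < n then v i else if i < n + 2 then 1 else 0)" for i
    have u: "u \<in> topspace (complex_space (n + 2))" by (simp add: u_def topspace_complex_space)
    obtain \<rho> where \<rho>: "0 < \<rho>" "\<And>s. cmod s < \<rho> \<Longrightarrow> (\<lambda>i. s * u i) \<in> polydisc (n + 2) r"
      by (rule scale_in_polydisc[OF u r(1)]) blast
    have "eventually (\<lambda>t. f (\<lambda>i. t * v i) / t ^ germ_order n f \<noteq> 0) (at 0)"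
      using tendsto_imp_eventually_ne[OF initial_form_properties(1)[OF f v(1)] v(2)] .
    moreover have "eventually (\<lambda>t. cmod t < \<rho>) (at 0)"
      using \<rho>(1) eventually_at[of "\<lambda>s. cmod s < \<rho>" 0 UNIV] by (auto intro!: exI[of _ "\<rho>"])
    moreover have "eventually (\<lambda>t. t \<noteq> 0) (at (0::complex))"
      by (rule eventually_neq_at_within)
    ultimately have "eventually (\<lambda>t. False) (at (0::complex))"
    proof eventually_elim
      case (elim t)
      have "trunc_at n (\<lambda>i. t * u i) = (\<lambda>i. t * v i)"
        using v(1) by (auto simp: trunc_at_def u_def topspace_complex_space)
      then have "(f (\<lambda>i. t * v i))\<^sup>2 * t * t = 0"
        using r(2)[OF \<rho>(2)[OF elim(2)]] by (simp add: A_def u_def)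
      with elim(1,3) show ?case by auto
    qed
    then show False by simp
  qed
  ultimately have "reduced_germ (Suc (n + 2)) (\<lambda>z. A (trunc_at (n + 2) z) + z (n + 2) ^ d)"
    using assms(2) by (rule reduced_germ_add_power)
  also have "(\<lambda>z. A (trunc_at (n + 2) z) + z (n + 2) ^ d) = suspended_germ n d f"
    by (rule ext) (simp add: A_def suspended_germ_def trunc_at_apply)
  finally show ?thesis by (simp add: numeral_3_eq_3)
qed

text \<open>The factor \<open>0 ^ k\<close> is 1 for \<open>k = 0\<close> and 0 otherwise. One
  formula thus covers both cases: a summand survives exactly when its degree equals
  \<open>e\<close>.\<close>

lemma tendsto_suspended_germ:
  assumes f: "holomorphic_germ n f" "\<not> germ_eq n f (\<lambda>_. 0)"
    and e: "e \<le> 2 * germ_order n f + 2" "e \<le> d"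
  shows "((\<lambda>t. suspended_germ n d f (\<lambda>i. t * z i) / t ^ e) \<longlongrightarrow>
      (initial_form n f (trunc_at n z))\<^sup>2 * z n * z (n + 1) * 0 ^ (2 * germ_order n f + 2 - e) +
      z (n + 2) ^ d * 0 ^ (d - e)) (at 0)"
proof -
  let ?m = "germ_order n f" and ?x = "trunc_at n z"
  have "((\<lambda>t. (f (\<lambda>i. t * ?x i) / t ^ ?m)\<^sup>2 * z n * z (n + 1) * t ^ (2 * ?m + 2 - e) + z (n + 2) ^ d * t ^ (d - e))
      \<longlongrightarrow> (initial_form n f ?x)\<^sup>2 * z n * z (n + 1) * 0 ^ (2 * ?m + 2 - e) + z (n + 2) ^ d * 0 ^ (d - e)) (at 0)"
    by (intro tendsto_intros initial_form_properties(1)[OF f] trunc_at_in_complex_space)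
  then show ?thesis
  proof (rule Lim_transform_within[OF _ zero_less_one])
    fix t :: complex assume "0 < dist t 0"
    then have t: "t \<noteq> 0" by simp
    have x: "trunc_at n (\<lambda>i. t * z i) = (\<lambda>i. t * ?x i)" by (auto simp: trunc_at_def)
    have "t ^ (2 * ?m + 2 - e) = (t ^ ?m)\<^sup>2 * t\<^sup>2 / t ^ e"
      using e t by (simp add: power_diff power_add power2_eq_square mult_2)
    moreover have "t ^ (d - e) = t ^ d / t ^ e"
      using e t by (simp add: power_diff)
    ultimately show "(f (\<lambda>i. t * ?x i) / t ^ ?m)\<^sup>2 * z n * z (n + 1) * t ^ (2 * ?m + 2 - e) + z (n + 2) ^ d * t ^ (d - e)
        = suspended_germ n d f (\<lambda>i. t * z i) / t ^ e"
      using t by (simp add: suspended_germ_def x add_divide_distrib power_mult_distrib power_divide power2_eq_square mult_ac)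
  qed
qed

lemma initial_form_suspended_germ_low:
  assumes f: "reduced_germ n f" and d: "2 * germ_order n f + 2 < d"
    and z: "z \<in> topspace (complex_space (n + 3))"
  shows "initial_form (n + 3) (suspended_germ n d f) z = (initial_form n f (trunc_at n z))\<^sup>2 * z n * z (n + 1)"
proof -
  have f': "holomorphic_germ n f" "\<not> germ_eq n f (\<lambda>_. 0)"
    using f by (auto simp: reduced_germ_def)
  obtain v where v: "v \<in> topspace (complex_space n)" "initial_form n f v \<noteq> 0"
    using initial_form_properties(3)[OF f'] by blast
  \<comment> \<open>The direction \<open>(v, 1, 1, 0)\<close>, at which the expected form is
    nonzero.\<close>
  define u where "u i = (if i < n then v i else if i < n + 2 then 1 else 0)" for i
  have u: "u \<in> topspace (complex_space (n + 3))" by (simp add: u_def topspace_complex_space)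
  have "trunc_at n u = v" using v(1) by (auto simp: trunc_at_def u_def topspace_complex_space)
  then have nz: "(initial_form n f (trunc_at n u))\<^sup>2 * u n * u (n + 1) \<noteq> 0"
    using v(2) by (simp add: u_def)
  have hol: "holomorphic_germ (n + 3) (suspended_germ n d f)"
    using reduced_suspended_germ[OF f, of d] d by (simp add: reduced_germ_def)
  show ?thesis
    by (rule germ_order_initial_form_eq(2)[OF hol u, where e = "2 * germ_order n f + 2"
          and R = "\<lambda>z. (initial_form n f (trunc_at n z))\<^sup>2 * z n * z (n + 1)", OF nz _ z])
       (use tendsto_suspended_germ[OF f', of "2 * germ_order n f + 2" d] d in \<open>simp add: zero_power\<close>)
qed

lemma initial_form_suspended_germ_high:
  assumes f: "reduced_germ n f" and d: "2 \<le> d" "d < 2 * germ_order n f + 2"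
    and z: "z \<in> topspace (complex_space (n + 3))"
  shows "initial_form (n + 3) (suspended_germ n d f) z = z (n + 2) ^ d"
proof -
  have f': "holomorphic_germ n f" "\<not> germ_eq n f (\<lambda>_. 0)"
    using f by (auto simp: reduced_germ_def)
  define u where "u i = (if i = n + 2 then 1 else 0 :: complex)" for i
  have u: "u \<in> topspace (complex_space (n + 3))" by (simp add: u_def topspace_complex_space)
  have nz: "u (n + 2) ^ d \<noteq> 0" by (simp add: u_def)
  have hol: "holomorphic_germ (n + 3) (suspended_germ n d f)"
    using reduced_suspended_germ[OF f d(1)] by (simp add: reduced_germ_def)
  show ?thesis
    by (rule germ_order_initial_form_eq(2)[OF hol u, where e = d and R = "\<lambda>z. z (n + 2) ^ d", OF nz _ z])
       (use tendsto_suspended_germ[OF f', of d d] d in \<open>simp add: zero_power\<close>)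
qed

text \<open>Degree \<open>2 * n + 2\<close> is the dimension of the sphere equivalent to R^(2n+3) -
  0. The sphere equivalent to C^(n+2) - 0 has dimension \<open>2 * n + 3\<close>, and the degree is
  positive, so its homology vanishes there.\<close>

lemma not_same_homology_suspended_germs:
  assumes f: "reduced_germ n f" and g: "reduced_germ n g" and less: "germ_order n f < germ_order n g"
    and d: "d = 2 * germ_order n f + 3"
  shows "\<not> homology_group (2 * int n + 2) (punctured_initial_cone (n + 3) (suspended_germ n d f)) \<cong>
      homology_group (2 * int n + 2) (punctured_initial_cone (n + 3) (suspended_germ n d g))"
proof -
  let ?p = "2 * int n + 2"
  let ?X = "punctured_initial_cone (n + 3) (suspended_germ n d f)"
  let ?Y = "punctured_initial_cone (n + 3) (suspended_germ n d g)"
  have f': "holomorphic_germ n f" "\<not> germ_eq n f (\<lambda>_. 0)"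
    using f by (auto simp: reduced_germ_def)
  obtain v where v: "v \<in> topspace (complex_space n)" "initial_form n f v \<noteq> 0"
    using initial_form_properties(3)[OF f'] by blast
  have "initial_form (n + 3) (suspended_germ n d f) z = (initial_form n f (trunc_at n z))\<^sup>2 * z n * z (n + 1)"
    if "z \<in> topspace (complex_space (n + 3))" for z
    using initial_form_suspended_germ_low[OF f _ that, of d] d by simp
  from section_map_punctured_Euclidean_space_cone[OF initial_form_properties(2)[OF f'] v this]
  obtain \<sigma> where "section_map (punctured_Euclidean_space (2 * n + 3)) ?X \<sigma>"
    unfolding punctured_initial_cone_def by blast
  moreover have "\<not> trivial_group (homology_group ?p (punctured_Euclidean_space (2 * n + 3)))"
    using trivial_homology_group_punctured_Euclidean_space[of ?p "2 * n + 2"] by (simp add: eval_nat_numeral)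
  ultimately have X: "\<not> trivial_group (homology_group ?p ?X)"
    using trivial_homology_group_section_map by blast
  \<comment> \<open>Since \<open>germ_order n g\<close> exceeds \<open>germ_order n f\<close> by at
    least 1, \<open>d < 2 * germ_order n g + 2\<close>, and \<open>w^d\<close> is the initial
    form.\<close>
  have "?Y = subtopology (complex_space (n + 2)) (- {origin})"
    using hyperplane_cone_eq[of "n + 2" "initial_form (n + 3) (suspended_germ n d g)" d]
      initial_form_suspended_germ_high[OF g, of d] d less
    by (simp add: punctured_initial_cone_def eval_nat_numeral)
  then have "?Y homeomorphic_space punctured_Euclidean_space (2 * (n + 2))"
    by (simp only: homeomorphic_space_punctured_complex_space)
  then have "homology_group ?p ?Y \<cong> homology_group ?p (punctured_Euclidean_space (2 * (n + 2)))"
    by (rule homeomorphic_space_imp_isomorphic_homology_groups)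
  moreover have "trivial_group (homology_group ?p (punctured_Euclidean_space (2 * (n + 2))))"
    using trivial_homology_group_punctured_Euclidean_space[of ?p "2 * n + 3"] by (simp add: eval_nat_numeral)
  ultimately have Y: "trivial_group (homology_group ?p ?Y)"
    by (simp add: isomorphic_group_triviality)
  show ?thesis
    using X Y isomorphic_group_triviality[of "homology_group ?p ?X" "homology_group ?p ?Y"] by auto
qed

text \<open>\<open>suspended_germ\<close> evaluates \<open>g\<close> at a truncated point. Near the
  origin the argument of \<open>\<phi>\<close> lies in \<open>U\<close>, so the value of
  \<open>\<phi>\<close> lies in C^n and the truncation does not change it.\<close>

lemma germ_eq_suspended_germ:
  assumes "homeomorphism_germ n \<phi>" "germ_eq n f (g \<circ> \<phi>)"
  shows "germ_eq (n + 3) (suspended_germ n d f) (suspended_germ n d g \<circ> extend_map n \<phi>)"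
proof -
  obtain U V where U: "openin (complex_space n) U" "origin \<in> U" "openin (complex_space n) V"
    "homeomorphic_map (subtopology (complex_space n) U) (subtopology (complex_space n) V) \<phi>"
    using assms(1) unfolding homeomorphism_germ_def by blast
  obtain r1 where r1: "0 < r1" "polydisc n r1 \<subseteq> U"
    by (rule openin_contains_polydisc[OF U(1,2)])
  obtain r2 where r2: "0 < r2" "\<And>z. z \<in> polydisc n r2 \<Longrightarrow> f z = g (\<phi> z)"
    using assms(2) by (auto simp: germ_eq_iff)
  have "suspended_germ n d f z = suspended_germ n d g (extend_map n \<phi> z)"
    if z: "z \<in> polydisc (n + 3) (min r1 r2)" for z
  proof -
    have t: "trunc_at n z \<in> polydisc n (min r1 r2)" using z by (rule trunc_at_in_polydisc) simp
    have "trunc_at n z \<in> polydisc n r1" "trunc_at n z \<in> polydisc n r2"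
      using subsetD[OF polydisc_mono t] by simp_all
    then have tU: "trunc_at n z \<in> U" and eq: "f (trunc_at n z) = g (\<phi> (trunc_at n z))"
      using subsetD[OF r1(2)] r2(2) by simp_all
    from tU have "trunc_at n z \<in> topspace (subtopology (complex_space n) U)" by simp
    from funcset_mem[OF continuous_map_funspace[OF homeomorphic_imp_continuous_map[OF U(4)]] this]
    have "\<phi> (trunc_at n z) \<in> topspace (complex_space n)" by simp
    with eq have "g (trunc_at n (extend_map n \<phi> z)) = f (trunc_at n z)"
      by (simp add: trunc_at_extend_map trunc_at_id)
    then show ?thesis by (simp add: suspended_germ_def) (simp add: extend_map_def)
  qed
  then show ?thesis
    unfolding germ_eq_iff using r1(1) r2(1) by (intro exI[of _ "min r1 r2"]) auto
qed

theorem proposition3p2: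
  assumes A: "\<forall>n\<ge>1. \<forall>f g. reduced_germ n f \<longrightarrow> reduced_germ n g \<longrightarrow>
      (\<exists>\<phi>. homeomorphism_germ n \<phi> \<and> germ_eq n f (g \<circ> \<phi>)) \<longrightarrow>
      same_homology (punctured_initial_cone n f) (punctured_initial_cone n g)"
  shows "\<forall>n\<ge>1. \<forall>f g. reduced_germ n f \<longrightarrow> reduced_germ n g \<longrightarrow>
      (\<exists>\<phi>. homeomorphism_germ n \<phi> \<and> germ_eq n f (g \<circ> \<phi>)) \<longrightarrow>
      hypersurface_multiplicity n f = hypersurface_multiplicity n g"
proof (intro allI impI)
  fix n f g
  assume f: "reduced_germ n f" and g: "reduced_germ n g"
    and "\<exists>\<phi>. homeomorphism_germ n \<phi> \<and> germ_eq n f (g \<circ> \<phi>)"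
  then obtain \<phi> where \<phi>: "homeomorphism_germ n \<phi>" "germ_eq n f (g \<circ> \<phi>)" by blast
  \<comment> \<open>Kept general in \<open>d\<close>, since each of the two cases below takes
    \<open>d\<close> from the smaller of the two orders.\<close>
  have iso: "homology_group p (punctured_initial_cone (n + 3) (suspended_germ n d f)) \<cong>
      homology_group p (punctured_initial_cone (n + 3) (suspended_germ n d g))" if "2 \<le> d" for d p
  proof -
    have "homeomorphism_germ (n + 3) (extend_map n \<phi>)"
      by (rule homeomorphism_germ_extend_map[OF \<phi>(1)]) simp
    then have "same_homology (punctured_initial_cone (n + 3) (suspended_germ n d f))
        (punctured_initial_cone (n + 3) (suspended_germ n d g))"
      using A[rule_format, of "n + 3", OF _ reduced_suspended_germ[OF f that] reduced_suspended_germ[OF g that]]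
        germ_eq_suspended_germ[OF \<phi>] by auto
    then show ?thesis by (simp add: same_homology_def)
  qed
  have "\<not> germ_order n f < germ_order n g"
    using not_same_homology_suspended_germs[OF f g _ refl] iso by auto
  \<comment> \<open>Exchanging \<open>f\<close> and \<open>g\<close> reverses the isomorphism of
    homology groups; the homeomorphism germ stays the same.\<close>
  moreover have "\<not> germ_order n g < germ_order n f"
    using not_same_homology_suspended_germs[OF g f _ refl] group.iso_sym[OF _ iso] by auto
  ultimately show "hypersurface_multiplicity n f = hypersurface_multiplicity n g"
    by (simp add: hypersurface_multiplicity_def)
qed

end
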